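(* For every integer $n\geq 2$, the graded character of the Artinian $F$-algebra $R_n/J_n$, as a graded representation of the group $S_{n-1}$ permuting the first $n-1$ variables $x_1,\ldots,x_{n-1}$, is \[ \chi_t\left(R_n/J_n\right)=\sum_{k=0}^{2n-4}t^k\sum_{l=0}^{\min(k,\,2n-4-k)}[\mathcal{P}_l(n-1)]\in\mathrm{Rep}(S_{n-1})[t]. \]
   Context: $F$ is an algebraically closed field of characteristic $0$, and $R_n=F[x_1,\ldots,x_n]$ with its standard grading ($\deg x_i=1$). For $n\geq 3$, $I_n\lhd R_n$ is the ideal generated by the $n$ polynomials $\left(\prod_{j\neq i}x_j\right)-x_i$, $1\leq i\leq n$; for $n=2$ one sets $I_2=\langle x_1,x_2\rangle\lhd F[x_1,x_2]$. Equip $R_n$ with the graded reverse lexicographic monomial order with $x_1>x_2>\cdots>x_n$, and let $J_n=\mathrm{in}_{\mathrm{GRevLex}}(I_n)\lhd R_n$ be the initial ideal of $I_n$, i.e. the monomial ideal generated by the leading monomials of all nonzero elements of $I_n$. The quotient $R_n/J_n$ is finite-dimensional over $F$. The ideal $J_n$ is invariant under the symmetric group $S_{n-1}$ permuting the variables $x_1,\ldots,x_{n-1}$ (and fixing $x_n$), so $R_n/J_n$ is a graded finite-dimensional $S_{n-1}$-representation. $\mathrm{Rep}(S_m)$ denotes the ring of finite-dimensional representations of $S_m$ over $F$. For a finite-dimensional $S_m$-representation $V$, $\chi(V)\in\mathrm{Rep}(S_m)$ is the corresponding ring element; for a graded finite-dimensional $S_m$-representation $V=\bigoplus_r V_r$,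 $\chi_t(V)=\sum_r\chi(V_r)t^r\in\mathrm{Rep}(S_m)[t]$. For $0\leq l\leq m$, $\mathcal{P}_l(m)$ is the set of all $l$-element subsets of $\{1,\ldots,m\}$ and $[\mathcal{P}_l(m)]\in\mathrm{Rep}(S_m)$ is the class of the corresponding permutation representation, of dimension $\binom{m}{l}$. *)

theory Defs
  imports
    "HOL-Algebra.Sym_Groups"
    "HOL-Algebra.UnivPoly"
    "HOL-Algebra.QuotRing"
    "HOL-Library.Poly_Mapping"
    "Jordan_Normal_Form.VS_Connect"
begin

section \<open>The polynomial ring, the ideal and its initial ideal\<close>

text \<open>A monomial \<open>x\<^sub>1\<^bsup>a 1\<^esup> x\<^sub>2\<^bsup>a 2\<^esup> \<dots>\<close> is the finitely supported exponent function \<open>a\<close>, and a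
  polynomial is a finitely supported function from monomials to coefficients; multiplication on
  this type is convolution.\<close>

type_synonym 'a mpoly = "(nat \<Rightarrow>\<^sub>0 nat) \<Rightarrow>\<^sub>0 'a"

definition var :: "nat \<Rightarrow> 'a::field mpoly" where
  "var i = Poly_Mapping.single (Poly_Mapping.single i 1) 1"

definition const :: "'a::field \<Rightarrow> 'a mpoly" where
  "const c = Poly_Mapping.single 0 c"

definition mpoly_ring :: "nat \<Rightarrow> 'a::field mpoly ring" where
  "mpoly_ring n = \<lparr>carrier = {p. \<forall>a \<in> Poly_Mapping.keys p. Poly_Mapping.keys a \<subseteq> {1..n}},
     mult = (*), one = 1, zero = 0, add = (+)\<rparr>"

lemma mpoly_ring_cring: "cring (mpoly_ring n :: 'a::field mpoly ring)"
proof -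
  define C :: "'a mpoly set"
    where "C = {p. \<forall>a \<in> Poly_Mapping.keys p. Poly_Mapping.keys a \<subseteq> {1..n}}"
  have R: "mpoly_ring n = \<lparr>carrier = C, mult = (*), one = 1, zero = 0, add = (+)\<rparr>"
    by (simp add: mpoly_ring_def C_def)
  have mult: "p * q \<in> C" if "p \<in> C" "q \<in> C" for p q
    unfolding C_def
  proof (intro CollectI ballI)
    fix a assume "a \<in> Poly_Mapping.keys (p * q)"
    then obtain b c where "a = b + c" "b \<in> Poly_Mapping.keys p" "c \<in> Poly_Mapping.keys q"
      using keys_mult[of p q] by blast
    then show "Poly_Mapping.keys a \<subseteq> {1..n}"
      using \<open>p \<in> C\<close> \<open>q \<in> C\<close> Poly_Mapping.keys_add[of b c] unfolding C_def by blast
  qed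
  have add: "p + q \<in> C" if "p \<in> C" "q \<in> C" for p q
    using Poly_Mapping.keys_add[of p q] that unfolding C_def by blast
  have minus: "- p \<in> C" if "p \<in> C" for p
    using that by (simp add: C_def)
  have zero_one: "0 \<in> C" "1 \<in> C"
    by (simp_all add: C_def)
  show ?thesis
  proof (rule cringI)
    show "abelian_group (mpoly_ring n :: 'a mpoly ring)"
    proof (rule abelian_groupI)
      fix x :: "'a mpoly"
      assume "x \<in> carrier (mpoly_ring n)"
      then show "\<exists>y\<in>carrier (mpoly_ring n). y \<oplus>\<^bsub>mpoly_ring n\<^esub> x = \<zero>\<^bsub>mpoly_ring n\<^esub>"
        by (intro bexI[of _ "- x"]) (simp_all add: R minus)
    qed (simp_all add: R add zero_one add_ac)
    show "comm_monoid (mpoly_ring n :: 'a mpoly ring)"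
      by (rule comm_monoidI) (simp_all add: R mult zero_one mult_ac)
  qed (simp add: R distrib_right)
qed

definition I_ideal :: "nat \<Rightarrow> 'a::field mpoly set" where
  "I_ideal n = Idl\<^bsub>mpoly_ring n\<^esub>
     (if n = 2 then {var 1, var 2}
      else {(\<Prod>j \<in> {1..n} - {i}. var j) - var i | i. i \<in> {1..n}})"

definition mdeg :: "(nat \<Rightarrow>\<^sub>0 nat) \<Rightarrow> nat" where
  "mdeg a = (\<Sum>i \<in> Poly_Mapping.keys a. Poly_Mapping.lookup a i)"

text \<open>Graded reverse lexicographic order with \<open>x\<^sub>1 > x\<^sub>2 > \<dots>\<close>: among monomials of equal degree,
  the one with the larger exponent at the last position where the two differ is the smaller.\<close>

definition grevlex_less :: "(nat \<Rightarrow>\<^sub>0 nat) \<Rightarrow> (nat \<Rightarrow>\<^sub>0 nat) \<Rightarrow> bool" where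
  "grevlex_less a b \<longleftrightarrow> mdeg a < mdeg b \<or>
     mdeg a = mdeg b \<and>
       (\<exists>i. Poly_Mapping.lookup a i > Poly_Mapping.lookup b i \<and>
            (\<forall>j > i. Poly_Mapping.lookup a j = Poly_Mapping.lookup b j))"

definition lead_monomial :: "'a::field mpoly \<Rightarrow> (nat \<Rightarrow>\<^sub>0 nat)" where
  "lead_monomial p = (THE a. a \<in> Poly_Mapping.keys p \<and>
     (\<forall>b \<in> Poly_Mapping.keys p. b \<noteq> a \<longrightarrow> grevlex_less b a))"

definition initial_ideal :: "nat \<Rightarrow> 'a::field mpoly set \<Rightarrow> 'a mpoly set" where
  "initial_ideal n I = Idl\<^bsub>mpoly_ring n\<^esub>
     {Poly_Mapping.single (lead_monomial f) 1 | f. f \<in> I \<and> f \<noteq> 0}"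

definition J_ideal :: "nat \<Rightarrow> 'a::field mpoly set" where
  "J_ideal n = initial_ideal n (I_ideal n)"

definition homogeneous :: "nat \<Rightarrow> 'a::field mpoly \<Rightarrow> bool" where
  "homogeneous r p \<longleftrightarrow> (\<forall>a \<in> Poly_Mapping.keys p. mdeg a = r)"

text \<open>The degree-\<open>r\<close> component of the quotient of \<open>mpoly_ring n\<close> by the (homogeneous) ideal \<open>J\<close>,
  i.e. the cosets of homogeneous polynomials of degree \<open>r\<close>, as a vector space over the
  coefficient field.\<close>

definition quot_component ::
    "nat \<Rightarrow> 'a::field mpoly set \<Rightarrow> nat \<Rightarrow> ('a, 'a mpoly set) module" where
  "quot_component n J r = (let R = mpoly_ring n; Q = R Quot J in
     \<lparr>carrier = {J +>\<^bsub>R\<^esub> p | p. p \<in> carrier R \<and> homogeneous r p},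
      mult = mult Q, one = one Q, zero = zero Q, add = add Q,
      smult = (\<lambda>c X. (J +>\<^bsub>R\<^esub> const c) \<otimes>\<^bsub>Q\<^esub> X)\<rparr>)"

text \<open>The linear extension of a map between bases.\<close>

definition lin_extend :: "('x \<Rightarrow> 'y) \<Rightarrow> ('x \<Rightarrow>\<^sub>0 'a) \<Rightarrow> ('y \<Rightarrow>\<^sub>0 'a::field)" where
  "lin_extend h f =
     (\<Sum>x \<in> Poly_Mapping.keys f. Poly_Mapping.single (h x) (Poly_Mapping.lookup f x))"

text \<open>The algebra automorphism with \<open>x\<^sub>i \<mapsto> x\<^bsub>\<sigma> i\<^esub>\<close>: the exponent of \<open>x\<^sub>j\<close> in the image of the
  monomial \<open>a\<close> is \<open>a (\<sigma>\<^sup>-\<^sup>1 j)\<close>.\<close>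

definition permute_vars :: "(nat \<Rightarrow> nat) \<Rightarrow> 'a::field mpoly \<Rightarrow> 'a mpoly" where
  "permute_vars \<sigma> = lin_extend (Poly_Mapping.map_key (inv_into UNIV \<sigma>))"

text \<open>The induced action on cosets: if \<open>J\<close> is \<open>\<sigma>\<close>-invariant, \<open>permute_vars \<sigma>\<close> maps
  the coset of \<open>p\<close> onto the coset of \<open>permute_vars \<sigma> p\<close>.\<close>

definition permute_cosets :: "(nat \<Rightarrow> nat) \<Rightarrow> 'a::field mpoly set \<Rightarrow> 'a mpoly set" where
  "permute_cosets \<sigma> X = permute_vars \<sigma> ` X"


section \<open>The representation ring\<close>

text \<open>Matrix representations of \<open>G\<close>. Every finite-dimensional representation is isomorphic to one of
  these, so they serve as generators of the representation ring. Values outside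
  \<open>carrier G\<close> are irrelevant: representations agreeing on \<open>carrier G\<close> are isomorphic.\<close>

definition mat_reps :: "('g, 'b) monoid_scheme \<Rightarrow> ('g \<Rightarrow> 'a::field mat) set" where
  "mat_reps G = {\<rho>. \<exists>d. (\<forall>g \<in> carrier G. \<rho> g \<in> carrier_mat d d) \<and> \<rho> \<one>\<^bsub>G\<^esub> = 1\<^sub>m d \<and>
     (\<forall>g \<in> carrier G. \<forall>h \<in> carrier G. \<rho> (g \<otimes>\<^bsub>G\<^esub> h) = \<rho> g * \<rho> h)}"

definition rep_iso ::
    "('g, 'b) monoid_scheme \<Rightarrow> ('g \<Rightarrow> 'a::field mat) \<Rightarrow> ('g \<Rightarrow> 'a mat) \<Rightarrow> bool" where
  "rep_iso G \<rho> \<sigma> \<longleftrightarrow> (\<exists>P Q. \<forall>g \<in> carrier G. similar_mat_wit (\<rho> g) (\<sigma> g) P Q)"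

definition rep_sum ::
    "('g \<Rightarrow> 'a::field mat) \<Rightarrow> ('g \<Rightarrow> 'a mat) \<Rightarrow> 'g \<Rightarrow> 'a mat" where
  "rep_sum \<rho> \<sigma> g = four_block_mat
     (\<rho> g) (0\<^sub>m (dim_row (\<rho> g)) (dim_col (\<sigma> g)))
     (0\<^sub>m (dim_row (\<sigma> g)) (dim_col (\<rho> g))) (\<sigma> g)"

definition kronecker :: "'a::field mat \<Rightarrow> 'a mat \<Rightarrow> 'a mat" where
  "kronecker A B = mat (dim_row A * dim_row B) (dim_col A * dim_col B)
     (\<lambda>(i, j). A $$ (i div dim_row B, j div dim_col B) * B $$ (i mod dim_row B, j mod dim_col B))"

definition rep_tensor ::
    "('g \<Rightarrow> 'a::field mat) \<Rightarrow> ('g \<Rightarrow> 'a mat) \<Rightarrow> 'g \<Rightarrow> 'a mat" where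
  "rep_tensor \<rho> \<sigma> g = kronecker (\<rho> g) (\<sigma> g)"

text \<open>\<open>free_rep_ring G\<close> is the free abelian group on the matrix representations of \<open>G\<close>, with the
  bilinear extension of the tensor product as multiplication. The representation ring is its
  quotient by the relations \<open>[\<rho>] = [\<sigma>]\<close> for \<open>\<rho> \<cong> \<sigma>\<close> and
  \<open>[\<rho> \<oplus> \<sigma>] = [\<rho>] + [\<sigma>]\<close>.\<close>

definition free_rep_ring ::
    "('g, 'b) monoid_scheme \<Rightarrow> (('g \<Rightarrow> 'a::field mat) \<Rightarrow>\<^sub>0 int) ring" where
  "free_rep_ring G =
     \<lparr>carrier = {x. Poly_Mapping.keys x \<subseteq> mat_reps G},
      mult = (\<lambda>x y. frag_extend (\<lambda>\<rho>. frag_extend (\<lambda>\<sigma>. frag_of (rep_tensor \<rho> \<sigma>)) y) x),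
      one = frag_of (\<lambda>_. 1\<^sub>m 1), zero = 0, add = (+)\<rparr>"

definition rep_relations ::
    "('g, 'b) monoid_scheme \<Rightarrow> (('g \<Rightarrow> 'a::field mat) \<Rightarrow>\<^sub>0 int) set" where
  "rep_relations G = Idl\<^bsub>free_rep_ring G\<^esub>
     ({frag_of \<rho> - frag_of \<sigma> | \<rho> \<sigma>.
         \<rho> \<in> mat_reps G \<and> \<sigma> \<in> mat_reps G \<and> rep_iso G \<rho> \<sigma>} \<union>
      {frag_of (rep_sum \<rho> \<sigma>) - (frag_of \<rho> + frag_of \<sigma>) | \<rho> \<sigma>.
         \<rho> \<in> mat_reps G \<and> \<sigma> \<in> mat_reps G})"

definition rep_ring ::
    "('g, 'b) monoid_scheme \<Rightarrow> (('g \<Rightarrow> 'a::field mat) \<Rightarrow>\<^sub>0 int) set ring" where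
  "rep_ring G = free_rep_ring G Quot rep_relations G"

lemma kronecker_dim [simp]:
  "dim_row (kronecker A B) = dim_row A * dim_row B"
  "dim_col (kronecker A B) = dim_col A * dim_col B"
  by (simp_all add: kronecker_def)

lemma kronecker_assoc: "kronecker (kronecker A B) C = kronecker A (kronecker B C)"
proof (rule eq_matI)
  fix i j
  assume "i < dim_row (kronecker A (kronecker B C))" "j < dim_col (kronecker A (kronecker B C))"
  then have i: "i < dim_row A * (dim_row B * dim_row C)" and j: "j < dim_col A * (dim_col B * dim_col C)"
    by simp_all
  have pos: "dim_row B > 0" "dim_row C > 0" "dim_col B > 0" "dim_col C > 0"
    using i j by (auto intro!: gr0I)
  have dm: "x mod (b * c) div c = x div c mod b" "x mod (b * c) mod c = x mod c"
      "x div (b * c) = x div c div b" if "c > 0" for x b c :: nat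
    using that by (simp_all add: mult.commute[of b c] mod_mult2_eq div_mult2_eq)
  have "i div dim_row C < dim_row A * dim_row B" "j div dim_col C < dim_col A * dim_col B"
    using i j by (simp_all add: less_mult_imp_div_less mult.assoc)
  moreover have "i mod (dim_row B * dim_row C) < dim_row B * dim_row C"
    "j mod (dim_col B * dim_col C) < dim_col B * dim_col C" using pos by simp_all
  ultimately show "kronecker (kronecker A B) C $$ (i, j) = kronecker A (kronecker B C) $$ (i, j)"
    using i j pos by (simp add: kronecker_def mult.assoc dm)
qed (simp_all add: mult.assoc)

lemma kronecker_one [simp]: "kronecker (1\<^sub>m 1) A = A" "kronecker A (1\<^sub>m 1) = A"
  by (rule eq_matI; simp add: kronecker_def)+

lemma kronecker_one_one: "kronecker (1\<^sub>m d) (1\<^sub>m e) = 1\<^sub>m (d * e)"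
proof (rule eq_matI)
  fix i j assume "i < dim_row (1\<^sub>m (d * e))" "j < dim_col (1\<^sub>m (d * e))"
  then have ij: "i < d * e" "j < d * e" by simp_all
  then have e: "e > 0" by (auto intro!: gr0I)
  have "i div e = j div e \<and> i mod e = j mod e \<longleftrightarrow> i = j"
    by (metis div_mult_mod_eq)
  then show "kronecker (1\<^sub>m d) (1\<^sub>m e) $$ (i, j) = (1\<^sub>m (d * e) :: 'a mat) $$ (i, j)"
    using ij e by (auto simp: kronecker_def less_mult_imp_div_less)
qed simp_all

lemma sum_div_mod:
  fixes F :: "nat \<Rightarrow> nat \<Rightarrow> 'a::comm_monoid_add"
  shows "(\<Sum>k<d * e. F (k div e) (k mod e)) = (\<Sum>a<d. \<Sum>b<e. F a b)"
proof (induction d)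
  case (Suc d)
  have "{..<Suc d * e} = {..<d * e} \<union> (\<lambda>b. d * e + b) ` {..<e}"
  proof -
    have "x \<in> (\<lambda>b. d * e + b) ` {..<e}" if "x < Suc d * e" "\<not> x < d * e" for x
      using that by (intro image_eqI[of _ _ "x - d * e"]) auto
    then show ?thesis by auto
  qed
  moreover have "(\<Sum>k\<in>(\<lambda>b. d * e + b) ` {..<e}. F (k div e) (k mod e)) = (\<Sum>b<e. F d b)"
    by (subst sum.reindex) (auto simp: inj_on_def)
  ultimately show ?case
    using Suc by (subst \<open>{..<Suc d * e} = _\<close>, subst sum.union_disjoint) auto
qed simp

lemma kronecker_mult:
  assumes "A \<in> carrier_mat d d" "A' \<in> carrier_mat d d" "B \<in> carrier_mat e e" "B' \<in> carrier_mat e e"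
  shows "kronecker (A * A') (B * B') = kronecker A B * kronecker A' B'"
proof (rule eq_matI)
  fix i j
  assume "i < dim_row (kronecker A B * kronecker A' B')" "j < dim_col (kronecker A B * kronecker A' B')"
  then have i: "i < d * e" and j: "j < d * e" using assms by simp_all
  then have e: "e > 0" by (auto intro!: gr0I)
  have ij: "i div e < d" "j div e < d" "i mod e < e" "j mod e < e"
    using i j e by (simp_all add: less_mult_imp_div_less)
  have kr: "kronecker X Y $$ (k, l) = X $$ (k div e, l div e) * Y $$ (k mod e, l mod e)"
    if "k < d * e" "l < d * e" "X \<in> carrier_mat d d" "Y \<in> carrier_mat e e" for X Y :: "'a mat" and k l
    using that by (simp add: kronecker_def)
  have mm: "(X * Y) $$ (k, l) = (\<Sum>r<m. X $$ (k, r) * Y $$ (r, l))"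
    if "k < m" "l < m" "X \<in> carrier_mat m m" "Y \<in> carrier_mat m m" for X Y :: "'a mat" and k l m
    using that by (auto simp: scalar_prod_def atLeast0LessThan intro!: sum.cong)
  have cK: "kronecker A B \<in> carrier_mat (d*e) (d*e)" "kronecker A' B' \<in> carrier_mat (d*e) (d*e)"
    using assms by auto
  have "kronecker (A * A') (B * B') $$ (i, j)
      = (\<Sum>a<d. A $$ (i div e, a) * A' $$ (a, j div e)) * (\<Sum>b<e. B $$ (i mod e, b) * B' $$ (b, j mod e))"
    unfolding kr[OF i j mult_carrier_mat[OF assms(1,2)] mult_carrier_mat[OF assms(3,4)]]
      mm[OF ij(1,2) assms(1,2)] mm[OF ij(3,4) assms(3,4)] ..
  also have "\<dots> = (\<Sum>a<d. \<Sum>b<e. (A $$ (i div e, a) * B $$ (i mod e, b)) * (A' $$ (a, j div e) * B' $$ (b, j mod e)))"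
    by (simp add: sum_product mult_ac)
  also have "\<dots> = (\<Sum>k<d * e. (A $$ (i div e, k div e) * B $$ (i mod e, k mod e)) * (A' $$ (k div e, j div e) * B' $$ (k mod e, j mod e)))"
    by (rule sum_div_mod[symmetric])
  also have "\<dots> = (\<Sum>k<d * e. kronecker A B $$ (i, k) * kronecker A' B' $$ (k, j))"
    using i j assms by (intro sum.cong) (simp_all add: kr)
  also have "\<dots> = (kronecker A B * kronecker A' B') $$ (i, j)"
    by (rule mm[symmetric]) (use i j cK in auto)
  finally show "kronecker (A * A') (B * B') $$ (i, j) = (kronecker A B * kronecker A' B') $$ (i, j)" .
qed (use assms in simp_all)

lemma rep_tensor_closed:
  assumes "\<rho> \<in> mat_reps G" "\<sigma> \<in> mat_reps G"
  shows "rep_tensor \<rho> \<sigma> \<in> mat_reps G"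
proof -
  obtain d where d: "\<And>g. g \<in> carrier G \<Longrightarrow> \<rho> g \<in> carrier_mat d d" "\<rho> \<one>\<^bsub>G\<^esub> = 1\<^sub>m d"
    "\<And>g h. g \<in> carrier G \<Longrightarrow> h \<in> carrier G \<Longrightarrow> \<rho> (g \<otimes>\<^bsub>G\<^esub> h) = \<rho> g * \<rho> h"
    using assms(1) by (auto simp: mat_reps_def)
  obtain e where e: "\<And>g. g \<in> carrier G \<Longrightarrow> \<sigma> g \<in> carrier_mat e e" "\<sigma> \<one>\<^bsub>G\<^esub> = 1\<^sub>m e"
    "\<And>g h. g \<in> carrier G \<Longrightarrow> h \<in> carrier G \<Longrightarrow> \<sigma> (g \<otimes>\<^bsub>G\<^esub> h) = \<sigma> g * \<sigma> h"
    using assms(2) by (auto simp: mat_reps_def)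
  have "rep_tensor \<rho> \<sigma> g \<in> carrier_mat (d * e) (d * e)" if "g \<in> carrier G" for g
    using carrier_matD[OF d(1)[OF that]] carrier_matD[OF e(1)[OF that]]
    by (intro carrier_matI) (simp_all only: rep_tensor_def kronecker_dim)
  moreover have "rep_tensor \<rho> \<sigma> \<one>\<^bsub>G\<^esub> = 1\<^sub>m (d * e)"
    by (simp only: rep_tensor_def d(2) e(2) kronecker_one_one)
  moreover have "rep_tensor \<rho> \<sigma> (g \<otimes>\<^bsub>G\<^esub> h) = rep_tensor \<rho> \<sigma> g * rep_tensor \<rho> \<sigma> h"
    if gh: "g \<in> carrier G" "h \<in> carrier G" for g h
    unfolding rep_tensor_def d(3)[OF gh] e(3)[OF gh]
    by (rule kronecker_mult) (rule d(1) e(1), rule gh)+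
  ultimately show ?thesis
    unfolding mat_reps_def by (intro CollectI exI[of _ "d * e"] conjI ballI)
qed

lemma rep_tensor_assoc: "rep_tensor (rep_tensor \<rho> \<sigma>) \<tau> = rep_tensor \<rho> (rep_tensor \<sigma> \<tau>)"
  by (simp add: fun_eq_iff rep_tensor_def kronecker_assoc)

lemma rep_tensor_one [simp]: "rep_tensor (\<lambda>_. 1\<^sub>m 1) \<rho> = \<rho>" "rep_tensor \<rho> (\<lambda>_. 1\<^sub>m 1) = \<rho>"
  by (rule ext, simp only: rep_tensor_def kronecker_one)+

lemma free_rep_ring_ring: "ring (free_rep_ring G :: (('g \<Rightarrow> 'a::field mat) \<Rightarrow>\<^sub>0 int) ring)"
proof -
  let ?R = "free_rep_ring G :: (('g \<Rightarrow> 'a mat) \<Rightarrow>\<^sub>0 int) ring"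
  define M :: "_ \<Rightarrow> _ \<Rightarrow> ('g \<Rightarrow> 'a mat) \<Rightarrow>\<^sub>0 int"
    where "M = (\<lambda>x y. frag_extend (\<lambda>\<rho>. frag_extend (\<lambda>\<sigma>. frag_of (rep_tensor \<rho> \<sigma>)) y) x)"
  have add_l: "M (x + y) z = M x z + M y z" for x y z
    by (simp add: M_def frag_extend_add)
  have diff_l: "M (x - y) z = M x z - M y z" for x y z
    by (simp add: M_def frag_extend_diff)
  have zero_l: "M 0 z = 0" for z
    by (simp add: M_def)
  have of_l: "M (frag_of \<rho>) z = frag_extend (\<lambda>\<sigma>. frag_of (rep_tensor \<rho> \<sigma>)) z" for \<rho> z
    by (simp add: M_def)
  have diff_r: "M x (y - z) = M x y - M x z" for x y z
    by (induction x rule: frag_induction[OF subset_UNIV]) 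
       (simp_all add: zero_l of_l diff_l frag_extend_diff)
  have add_r: "M x (y + z) = M x y + M x z" for x y z
    by (induction x rule: frag_induction[OF subset_UNIV]) 
       (simp_all add: zero_l of_l diff_l frag_extend_add)
  have zero_r: "M z 0 = 0" for z
    using diff_r[of z 0 0] by simp
  have of_of: "M (frag_of \<rho>) (frag_of \<sigma>) = frag_of (rep_tensor \<rho> \<sigma>)" for \<rho> \<sigma>
    by (simp add: M_def)
  have assoc: "M (M x y) z = M x (M y z)" for x y z
  proof (induction x rule: frag_induction[OF subset_UNIV])
    case (2 \<rho>)
    show ?case
    proof (induction y rule: frag_induction[OF subset_UNIV])
      case (2 \<sigma>)
      show ?case
        by (induction z rule: frag_induction[OF subset_UNIV])
           (simp_all add: zero_r zero_l of_of rep_tensor_assoc diff_r)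
    qed (simp_all add: zero_r zero_l diff_r diff_l)
  qed (simp_all add: zero_l diff_l)
  have one_l: "M (frag_of (\<lambda>_. 1\<^sub>m 1)) x = x" for x
    by (induction x rule: frag_induction[OF subset_UNIV])
       (simp_all add: zero_r of_of diff_r del: One_nat_def)
  have one_r: "M x (frag_of (\<lambda>_. 1\<^sub>m 1)) = x" for x
    by (induction x rule: frag_induction[OF subset_UNIV])
       (simp_all add: zero_l of_of diff_l del: One_nat_def)
  have closed: "Poly_Mapping.keys (M x y) \<subseteq> mat_reps G"
    if "Poly_Mapping.keys x \<subseteq> mat_reps G" "Poly_Mapping.keys y \<subseteq> mat_reps G" for x y
    using that(1)
  proof (induction x rule: frag_induction)
    case (one \<rho>)
    show ?case
      using that(2)
    proof (induction y rule: frag_induction)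
      case (diff a b)
      then show ?case using keys_diff[of "M (frag_of \<rho>) a" "M (frag_of \<rho>) b"] by (auto simp: diff_r)
    qed (use one in \<open>simp_all add: of_of zero_r rep_tensor_closed\<close>)
  next
    case (diff a b)
    then show ?case using keys_diff[of "M a y" "M b y"] by (auto simp: diff_l)
  qed (simp add: zero_l)
  have one: "(\<lambda>_. 1\<^sub>m 1) \<in> (mat_reps G :: ('g \<Rightarrow> 'a mat) set)"
    by (auto simp: mat_reps_def simp del: One_nat_def intro!: exI[of _ 1])
  have R: "free_rep_ring G = \<lparr>carrier = {x. Poly_Mapping.keys x \<subseteq> mat_reps G},
      mult = M, one = frag_of (\<lambda>_. 1\<^sub>m 1), zero = 0, add = (+)\<rparr>"
    by (simp add: free_rep_ring_def M_def)
  have add_closed: "Poly_Mapping.keys (x + y) \<subseteq> mat_reps G"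
    if "Poly_Mapping.keys x \<subseteq> mat_reps G" "Poly_Mapping.keys y \<subseteq> mat_reps G"
    for x y :: "('g \<Rightarrow> 'a mat) \<Rightarrow>\<^sub>0 int"
    using that Poly_Mapping.keys_add[of x y] by blast
  show ?thesis
  proof (rule ringI)
    show "abelian_group ?R"
    proof (rule abelian_groupI)
      fix x assume "x \<in> carrier ?R"
      then show "\<exists>y\<in>carrier ?R. y \<oplus>\<^bsub>?R\<^esub> x = \<zero>\<^bsub>?R\<^esub>"
        by (intro bexI[of _ "- x"]) (auto simp: R)
    qed (simp_all add: R add_closed add_ac)
    show "monoid ?R"
      by (rule monoidI) (use one in \<open>simp_all add: R closed assoc one_l one_r del: One_nat_def\<close>)
  qed (simp_all add: R add_l add_r)
qed


lemma rep_relations_ideal: "ideal (rep_relations G) (free_rep_ring G :: (('g \<Rightarrow> 'a::field mat) \<Rightarrow>\<^sub>0 int) ring)"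
  and rep_ring_ring: "ring (rep_ring G :: (('g \<Rightarrow> 'a::field mat) \<Rightarrow>\<^sub>0 int) set ring)"
proof -
  have sum: "rep_sum \<rho> \<sigma> \<in> mat_reps G" if rs: "\<rho> \<in> mat_reps G" "\<sigma> \<in> mat_reps G"
    for \<rho> \<sigma> :: "'g \<Rightarrow> 'a mat"
  proof -
    obtain d where d: "\<forall>g \<in> carrier G. \<rho> g \<in> carrier_mat d d" "\<rho> \<one>\<^bsub>G\<^esub> = 1\<^sub>m d"
      "\<forall>g \<in> carrier G. \<forall>h \<in> carrier G. \<rho> (g \<otimes>\<^bsub>G\<^esub> h) = \<rho> g * \<rho> h"
      using rs unfolding mat_reps_def by blast
    obtain e where e: "\<forall>g \<in> carrier G. \<sigma> g \<in> carrier_mat e e" "\<sigma> \<one>\<^bsub>G\<^esub> = 1\<^sub>m e"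
      "\<forall>g \<in> carrier G. \<forall>h \<in> carrier G. \<sigma> (g \<otimes>\<^bsub>G\<^esub> h) = \<sigma> g * \<sigma> h"
      using rs unfolding mat_reps_def by blast
    have "\<forall>g \<in> carrier G. rep_sum \<rho> \<sigma> g \<in> carrier_mat (d + e) (d + e)"
      using d(1) e(1) by (auto simp: rep_sum_def)
    moreover have "rep_sum \<rho> \<sigma> \<one>\<^bsub>G\<^esub> = 1\<^sub>m (d + e)"
      by (simp add: rep_sum_def d(2) e(2) four_block_one_mat)
    moreover have "rep_sum \<rho> \<sigma> (g \<otimes>\<^bsub>G\<^esub> h) = rep_sum \<rho> \<sigma> g * rep_sum \<rho> \<sigma> h"
      if gh: "g \<in> carrier G" "h \<in> carrier G" for g h
    proof -
      have c: "\<rho> g \<in> carrier_mat d d" "\<rho> h \<in> carrier_mat d d" "\<sigma> g \<in> carrier_mat e e" "\<sigma> h \<in> carrier_mat e e"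
        using d e gh by auto
      then have "rep_sum \<rho> \<sigma> g = four_block_mat (\<rho> g) (0\<^sub>m d e) (0\<^sub>m e d) (\<sigma> g)"
        "rep_sum \<rho> \<sigma> h = four_block_mat (\<rho> h) (0\<^sub>m d e) (0\<^sub>m e d) (\<sigma> h)"
        by (auto simp: rep_sum_def)
      then show ?thesis
        using c d(3) e(3) gh
        by (simp add: mult_four_block_mat[of _ d d _ e _ e _ _ d _ e]) (simp add: rep_sum_def)
    qed
    ultimately show ?thesis
      unfolding mat_reps_def by blast
  qed
  have keys: "Poly_Mapping.keys (x - y) \<subseteq> mat_reps G"
    if "Poly_Mapping.keys x \<subseteq> mat_reps G" "Poly_Mapping.keys y \<subseteq> mat_reps G"
    for x y :: "('g \<Rightarrow> 'a mat) \<Rightarrow>\<^sub>0 int"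
    using keys_diff[of x y] that by blast
  have keys_add: "Poly_Mapping.keys (x + y) \<subseteq> mat_reps G"
    if "Poly_Mapping.keys x \<subseteq> mat_reps G" "Poly_Mapping.keys y \<subseteq> mat_reps G"
    for x y :: "('g \<Rightarrow> 'a mat) \<Rightarrow>\<^sub>0 int"
    using Poly_Mapping.keys_add[of x y] that by blast
  interpret ring "free_rep_ring G :: (('g \<Rightarrow> 'a mat) \<Rightarrow>\<^sub>0 int) ring"
    by (rule free_rep_ring_ring)
  let ?S = "{frag_of \<rho> - frag_of \<sigma> | \<rho> \<sigma> :: 'g \<Rightarrow> 'a mat.
      \<rho> \<in> mat_reps G \<and> \<sigma> \<in> mat_reps G \<and> rep_iso G \<rho> \<sigma>}"
  let ?T = "{frag_of (rep_sum \<rho> \<sigma>) - (frag_of \<rho> + frag_of \<sigma>) | \<rho> \<sigma> :: 'g \<Rightarrow> 'a mat.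
      \<rho> \<in> mat_reps G \<and> \<sigma> \<in> mat_reps G}"
  have keys_of: "Poly_Mapping.keys (frag_of \<rho>) \<subseteq> mat_reps G" if "\<rho> \<in> mat_reps G" for \<rho> :: "'g \<Rightarrow> 'a mat"
    using that by simp
  have "x \<in> carrier (free_rep_ring G)" if "x \<in> ?S \<union> ?T" for x
  proof -
    have "Poly_Mapping.keys x \<subseteq> mat_reps G"
      using \<open>x \<in> ?S \<union> ?T\<close>
    proof
      assume "x \<in> ?S"
      then obtain \<rho> \<sigma> where "\<rho> \<in> mat_reps G" "\<sigma> \<in> mat_reps G" "x = frag_of \<rho> - frag_of \<sigma>"
        by blast
      then show ?thesis using keys[OF keys_of keys_of] by blast
    next
      assume "x \<in> ?T"
      then obtain \<rho> \<sigma> where "\<rho> \<in> mat_reps G" "\<sigma> \<in> mat_reps G"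
        "x = frag_of (rep_sum \<rho> \<sigma>) - (frag_of \<rho> + frag_of \<sigma>)"
        by blast
      then show ?thesis using keys[OF keys_of[OF sum] keys_add[OF keys_of keys_of]] by blast
    qed
    then show ?thesis by (simp add: free_rep_ring_def)
  qed
  then show id: "ideal (rep_relations G) (free_rep_ring G :: (('g \<Rightarrow> 'a mat) \<Rightarrow>\<^sub>0 int) ring)"
    unfolding rep_relations_def by (intro genideal_ideal subsetI)
  show "ring (rep_ring G :: (('g \<Rightarrow> 'a mat) \<Rightarrow>\<^sub>0 int) set ring)"
    unfolding rep_ring_def by (rule ideal.quotient_is_ring[OF id])
qed

text \<open>\<open>\<rho>\<close> is the matrix form, in some basis, of the finite-dimensional vector space \<open>V\<close> on which
  \<open>G\<close> acts by \<open>\<phi>\<close>. It is unique up to isomorphism.\<close>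

definition matrix_form :: "('g, 'b) monoid_scheme \<Rightarrow> ('a::field, 'v) module \<Rightarrow>
    ('g \<Rightarrow> 'v \<Rightarrow> 'v) \<Rightarrow> ('g \<Rightarrow> 'a mat) \<Rightarrow> bool" where
  "matrix_form G V \<phi> \<rho> \<longleftrightarrow> \<rho> \<in> mat_reps G \<and>
     (\<exists>d f. (\<forall>g \<in> carrier G. \<rho> g \<in> carrier_mat d d) \<and>
        f \<in> LinearCombinations.module_hom class_ring (module_vec TYPE('a) d) V \<and>
        bij_betw f (carrier_vec d) (carrier V) \<and>
        (\<forall>g \<in> carrier G. \<forall>v \<in> carrier_vec d. f (\<rho> g *\<^sub>v v) = \<phi> g (f v)))"

definition rep_class :: "('g, 'b) monoid_scheme \<Rightarrow> ('a::field, 'v) module \<Rightarrow>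
    ('g \<Rightarrow> 'v \<Rightarrow> 'v) \<Rightarrow> (('g \<Rightarrow> 'a mat) \<Rightarrow>\<^sub>0 int) set" where
  "rep_class G V \<phi> =
     rep_relations G +>\<^bsub>free_rep_ring G\<^esub> frag_of (SOME \<rho>. matrix_form G V \<phi> \<rho>)"

text \<open>\<open>UP R\<close> represents a polynomial over \<open>R\<close> by its coefficient sequence; so the sum of
  the \<open>\<chi>(V\<^sub>r) t\<^sup>r\<close> is the function \<open>r \<mapsto> \<chi>(V\<^sub>r)\<close>.\<close>

definition graded_char :: "('g, 'b) monoid_scheme \<Rightarrow> (nat \<Rightarrow> ('a::field, 'v) module) \<Rightarrow>
    ('g \<Rightarrow> 'v \<Rightarrow> 'v) \<Rightarrow> nat \<Rightarrow> (('g \<Rightarrow> 'a mat) \<Rightarrow>\<^sub>0 int) set" where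
  "graded_char G V \<phi> = (\<lambda>r. rep_class G (V r) \<phi>)"

definition free_space :: "'x set \<Rightarrow> ('a::field, 'x \<Rightarrow>\<^sub>0 'a) module" where
  "free_space X = \<lparr>carrier = {f. Poly_Mapping.keys f \<subseteq> X},
     mult = undefined, one = undefined, zero = 0, add = (+),
     smult = (\<lambda>c. Poly_Mapping.map ((*) c))\<rparr>"

definition subsets_of_size :: "nat \<Rightarrow> nat \<Rightarrow> nat set set" where
  "subsets_of_size l m = {A. A \<subseteq> {1..m} \<and> card A = l}"

text \<open>The class of the permutation representation of \<open>S\<^sub>m\<close> on \<open>l\<close>-element subsets of
  \<open>{1..m}\<close>, with \<open>\<sigma>\<close> sending the basis vector of \<open>A\<close> to that of \<open>\<sigma> ` A\<close>.\<close>

definition subset_rep_class ::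
    "nat \<Rightarrow> nat \<Rightarrow> (((nat \<Rightarrow> nat) \<Rightarrow> 'a::field mat) \<Rightarrow>\<^sub>0 int) set" where
  "subset_rep_class l m =
     rep_class (sym_group m) (free_space (subsets_of_size l m)) (\<lambda>\<sigma>. lin_extend (image \<sigma>))"

end

theory Submission
  imports Defs
begin

text \<open>
  The generators of \<open>I\<^sub>n\<close> are differences of two monomials, so computing modulo \<open>I\<^sub>n\<close>
  means working with an equivalence relation on exponent vectors.

  Let \<open>n \<ge> 3\<close>. Call a monomial standard if it is \<open>x\<^sub>A x\<^sub>n\<^sup>m\<close> with \<open>A \<subseteq> {1..n-1}\<close> and
  \<open>m + 2|A| \<le> 2n - 4\<close>, where \<open>x\<^sub>A\<close> is the product of the \<open>x\<^sub>i\<close> with \<open>i \<in> A\<close>. The heart of the proof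
  is \<open>J_ideal_eq\<close>: the monomials in \<open>J\<^sub>n\<close> are exactly the nonstandard ones. This
  combines two facts.

  \<^item> Every nonstandard monomial is a leading monomial (\<open>nonstandard_reducible\<close>). Multiplying the
    \<open>i\<close>-th generator by \<open>x\<^sub>i\<close> shows that all squares \<open>x\<^sub>i\<^sup>2\<close> are congruent to \<open>x\<^sub>1 \<cdots> x\<^sub>n\<close>, hence to each
    other. So \<open>x\<^sub>i\<^sup>2\<close> can be replaced by \<open>x\<^sub>n\<^sup>2\<close>, which is smaller in GRevLex. For a nonempty \<open>T\<close> with
    complement \<open>S\<close> in \<open>{1..n-1}\<close> and \<open>i \<in> T\<close>, the generator \<open>x\<^sub>S x\<^bsub>T - {i}\<^esub> x\<^sub>n - x\<^sub>i\<close> times \<open>x\<^bsub>T - {i}\<^esub>\<close>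
    shows \<open>x\<^sub>S x\<^sub>n\<^bsup>2|T|-1\<^esup>\<close> to be congruent to \<open>x\<^sub>T\<close>, whose degree is lower by \<open>n - 2\<close>; for empty \<open>T\<close>
    the last generator replaces \<open>x\<^sub>S\<close> by \<open>x\<^sub>n\<close>.

  \<^item> No standard monomial is a leading monomial (\<open>lead_monomial_not_standard\<close>). Away from the
    monomial \<open>1\<close>, the generators only identify exponent vectors that are congruent modulo the
    lattice spanned by the vectors \<open>(1,\<dots>,1) - 2e\<^sub>i\<close>, so for \<open>f \<in> I\<^sub>n\<close> the coefficients in each class
    of \<open>lattice_cong\<close> add up to zero (\<open>pairing_I_ideal\<close>). A standard monomial is the least element of
    its class (\<open>standard_minimal\<close>). If it were the leading monomial of \<open>f\<close>, then all other
    monomials of \<open>f\<close> would lie in other classes, and the sum over its class would be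
    the leading coefficient, which is not zero.

  For \<open>n = 2\<close> the only standard monomial is \<open>1\<close>, and \<open>J\<^sub>2\<close> is spanned by all other monomials.

  Consequently the degree \<open>r\<close> part of \<open>R\<^sub>n/J\<^sub>n\<close> has as a basis the classes of the monomials
  \<open>x\<^sub>A x\<^sub>n\<^bsup>r-|A|\<^esup>\<close> for \<open>|A| \<le> r\<close> and \<open>|A| \<le> 2n - 4 - r\<close>, and \<open>S\<^bsub>n-1\<^esub>\<close> permutes
  this basis as it permutes the sets \<open>A\<close> (\<open>component_iso_hom\<close>, \<open>component_iso_bij\<close>,
  \<open>component_iso_equivariant\<close>). It is therefore the permutation representation on the disjoint union
  of the \<open>P\<^sub>l(n-1)\<close> with \<open>l \<le> min r (2n - 4 - r)\<close>.

  To pass to the representation ring, note that the class of a representation is defined through some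
  matrix form, and that any two matrix forms are isomorphic (\<open>matrix_form_unique\<close>). So it can be
  computed from permutation matrices, for which a list of basis elements split into two
  invariant blocks gives a block diagonal matrix (\<open>perm_rep_append\<close>).
\<close>

section \<open>Degrees and the graded reverse lexicographic order\<close>

lemma mdeg_eq_sum:
  assumes "finite S" "Poly_Mapping.keys a \<subseteq> S"
  shows "mdeg a = (\<Sum>i\<in>S. Poly_Mapping.lookup a i)"
  unfolding mdeg_def using assms
  by (intro sum.mono_neutral_left) (auto simp: in_keys_iff)

lemma mdeg_add: "mdeg (a + b) = mdeg a + mdeg b"
proof -
  let ?S = "Poly_Mapping.keys a \<union> Poly_Mapping.keys b"
  have "mdeg (a + b) = (\<Sum>i\<in>?S. Poly_Mapping.lookup (a + b) i)"
    "mdeg a = (\<Sum>i\<in>?S. Poly_Mapping.lookup a i)"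
    "mdeg b = (\<Sum>i\<in>?S. Poly_Mapping.lookup b i)"
    using Poly_Mapping.keys_add[of a b] by (auto intro!: mdeg_eq_sum)
  then show ?thesis
    by (simp add: lookup_add sum.distrib)
qed

lemma mdeg_zero [simp]: "mdeg 0 = 0"
  by (simp add: mdeg_def)

lemma mdeg_single [simp]: "mdeg (Poly_Mapping.single i k) = k"
  by (simp add: mdeg_def)

lemma mdeg_eq_0_iff: "mdeg a = 0 \<longleftrightarrow> a = 0"
proof
  assume "mdeg a = 0"
  then show "a = 0"
    by (intro poly_mapping_eqI) (auto simp: mdeg_def in_keys_iff)
qed simp

lemma mdeg_sum: "mdeg (\<Sum>i\<in>S. f i) = (\<Sum>i\<in>S. mdeg (f i))"
  by (induction S rule: infinite_finite_induct) (auto simp: mdeg_add)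

lemma grevlex_trans:
  assumes "grevlex_less a b" "grevlex_less b c"
  shows "grevlex_less a c"
proof (cases "mdeg a = mdeg b \<and> mdeg b = mdeg c")
  case True
  with assms obtain i j where
    i: "Poly_Mapping.lookup a i > Poly_Mapping.lookup b i"
       "\<forall>k>i. Poly_Mapping.lookup a k = Poly_Mapping.lookup b k" and
    j: "Poly_Mapping.lookup b j > Poly_Mapping.lookup c j"
       "\<forall>k>j. Poly_Mapping.lookup b k = Poly_Mapping.lookup c k"
    by (auto simp: grevlex_less_def)
  have "Poly_Mapping.lookup a (max i j) > Poly_Mapping.lookup c (max i j)"
    using i j by (cases i j rule: linorder_cases) (auto simp: max_def)
  moreover have "\<forall>k>max i j. Poly_Mapping.lookup a k = Poly_Mapping.lookup c k"
    using i j by auto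
  ultimately show ?thesis
    using True by (auto simp: grevlex_less_def)
qed (use assms in \<open>auto simp: grevlex_less_def\<close>)

lemma grevlex_irrefl: "\<not> grevlex_less a a"
  by (auto simp: grevlex_less_def)

lemma grevlex_total:
  assumes "a \<noteq> b"
  shows "grevlex_less a b \<or> grevlex_less b a"
proof (cases "mdeg a = mdeg b")
  case True
  define D where "D = {i. Poly_Mapping.lookup a i \<noteq> Poly_Mapping.lookup b i}"
  have "D \<subseteq> Poly_Mapping.keys a \<union> Poly_Mapping.keys b"
    by (auto simp: D_def in_keys_iff)
  then have fin: "finite D"
    by (rule finite_subset) simp
  have "D \<noteq> {}"
    using assms by (auto simp: D_def intro: poly_mapping_eqI)
  with fin have "Max D \<in> D"
    by (rule Max_in)
  moreover have "Poly_Mapping.lookup a k = Poly_Mapping.lookup b k" if "k > Max D" for k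
  proof (rule ccontr)
    assume "\<not> ?thesis"
    then have "k \<le> Max D"
      using fin by (intro Max_ge) (auto simp: D_def)
    with that show False
      by simp
  qed
  ultimately obtain i where i: "Poly_Mapping.lookup a i \<noteq> Poly_Mapping.lookup b i"
      "\<forall>k>i. Poly_Mapping.lookup a k = Poly_Mapping.lookup b k"
    unfolding D_def by blast
  then have "Poly_Mapping.lookup a i < Poly_Mapping.lookup b i \<or>
      Poly_Mapping.lookup b i < Poly_Mapping.lookup a i"
    by arith
  then show ?thesis
    unfolding grevlex_less_def using True i(2) by metis
qed (auto simp: grevlex_less_def)

text \<open>Totality and transitivity give every nonempty finite set of monomials a largest element, so the
  definite description in \<open>lead_monomial\<close> denotes something.\<close>

lemma finite_has_grevlex_max:
  assumes "finite A" "A \<noteq> {}"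
  shows "\<exists>a\<in>A. \<forall>b\<in>A. b \<noteq> a \<longrightarrow> grevlex_less b a"
  using assms
proof (induction rule: finite_ne_induct)
  case (insert x A)
  then obtain a where a: "a \<in> A" "\<forall>b\<in>A. b \<noteq> a \<longrightarrow> grevlex_less b a"
    by blast
  have "grevlex_less x a \<or> grevlex_less a x"
    using a insert.hyps by (intro grevlex_total) auto
  then show ?case
  proof
    assume "grevlex_less x a"
    then show ?thesis
      using a by (intro bexI[of _ a]) auto
  next
    assume "grevlex_less a x"
    then have "grevlex_less b x" if "b \<in> A" for b
      using a(2) that grevlex_trans[of b a x] by (cases "b = a") auto
    then show ?thesis
      by (intro bexI[of _ x]) auto
  qed
qed auto

lemma lead_monomial_eqI:
  assumes "a \<in> Poly_Mapping.keys p"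
    and "\<And>b. b \<in> Poly_Mapping.keys p \<Longrightarrow> b \<noteq> a \<Longrightarrow> grevlex_less b a"
  shows "lead_monomial p = a"
  unfolding lead_monomial_def
proof (rule the_equality)
  fix c
  assume c: "c \<in> Poly_Mapping.keys p \<and>
    (\<forall>b\<in>Poly_Mapping.keys p. b \<noteq> c \<longrightarrow> grevlex_less b c)"
  show "c = a"
  proof (rule ccontr)
    assume "c \<noteq> a"
    then have "grevlex_less c a" "grevlex_less a c"
      using c assms by auto
    then show False
      using grevlex_trans[of c a c] grevlex_irrefl[of c] by simp
  qed
qed (use assms in auto)

lemma lead_monomial:
  assumes "p \<noteq> 0"
  shows "lead_monomial p \<in> Poly_Mapping.keys p"
    and "b \<in> Poly_Mapping.keys p \<Longrightarrow> b \<noteq> lead_monomial p \<Longrightarrow> grevlex_less b (lead_monomial p)"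
proof -
  obtain a where a: "a \<in> Poly_Mapping.keys p"
    "\<forall>b\<in>Poly_Mapping.keys p. b \<noteq> a \<longrightarrow> grevlex_less b a"
    using finite_has_grevlex_max[of "Poly_Mapping.keys p"] assms by auto
  then have "lead_monomial p = a"
    by (intro lead_monomial_eqI) auto
  with a show "lead_monomial p \<in> Poly_Mapping.keys p"
    "b \<in> Poly_Mapping.keys p \<Longrightarrow> b \<noteq> lead_monomial p \<Longrightarrow> grevlex_less b (lead_monomial p)"
    by auto
qed

lemma lead_monomial_binomial:
  assumes "grevlex_less b a"
  shows "lead_monomial (Poly_Mapping.single a 1 - Poly_Mapping.single b 1 :: 'a::field mpoly) = a"
proof (rule lead_monomial_eqI)
  have "a \<noteq> b"
    using assms grevlex_irrefl[of a] by auto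
  then show "a \<in> Poly_Mapping.keys (Poly_Mapping.single a 1 - Poly_Mapping.single b 1 :: 'a mpoly)"
    by (simp add: in_keys_iff lookup_minus lookup_single)
next
  fix c
  assume "c \<in> Poly_Mapping.keys (Poly_Mapping.single a 1 - Poly_Mapping.single b 1 :: 'a mpoly)"
    and "c \<noteq> a"
  then have "c = b"
    by (auto simp: in_keys_iff lookup_minus lookup_single when_def split: if_splits)
  with assms show "grevlex_less c a"
    by simp
qed

section \<open>Ideals of the polynomial ring\<close>

lemma poly_mapping_eq_sum_single:
  fixes p :: "'x \<Rightarrow>\<^sub>0 'a::comm_monoid_add"
  shows "p = (\<Sum>a\<in>Poly_Mapping.keys p. Poly_Mapping.single a (Poly_Mapping.lookup p a))"
  by (rule poly_mapping_eqI)
     (simp add: lookup_sum lookup_single when_def in_keys_iff if_distrib cong: if_cong)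

lemma poly_mapping_induct_add [case_names zero single add]:
  fixes p :: "'x \<Rightarrow>\<^sub>0 'a::comm_monoid_add"
  assumes "P 0" "\<And>a c. P (Poly_Mapping.single a c)" "\<And>p q. P p \<Longrightarrow> P q \<Longrightarrow> P (p + q)"
  shows "P p"
proof -
  have "P (\<Sum>a\<in>A. Poly_Mapping.single a (Poly_Mapping.lookup p a))" for A
    by (induction A rule: infinite_finite_induct) (use assms in auto)
  then show ?thesis
    using poly_mapping_eq_sum_single[of p] by metis
qed

lemma mpoly_ring_simps [simp]:
  "mult (mpoly_ring n) = (*)" "one (mpoly_ring n) = 1" "zero (mpoly_ring n) = 0"
  "add (mpoly_ring n) = (+)"
  by (simp_all add: mpoly_ring_def)

lemma in_carrier_mpoly_ring_iff:
  "p \<in> carrier (mpoly_ring n) \<longleftrightarrow> (\<forall>a\<in>Poly_Mapping.keys p. Poly_Mapping.keys a \<subseteq> {1..n})"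
  by (simp add: mpoly_ring_def)

lemma mpoly_ring_ring: "ring (mpoly_ring n :: 'a::field mpoly ring)"
  using mpoly_ring_cring by (rule cring.axioms)

lemma mpoly_minus_closed:
  "p \<in> carrier (mpoly_ring n) \<Longrightarrow> - p \<in> carrier (mpoly_ring n :: 'a::field mpoly ring)"
  by (simp add: in_carrier_mpoly_ring_iff)

lemma mpoly_carrier_closed:
  fixes p q :: "'a::field mpoly"
  shows "p \<in> carrier (mpoly_ring n) \<Longrightarrow> q \<in> carrier (mpoly_ring n) \<Longrightarrow> p + q \<in> carrier (mpoly_ring n)"
    and "p \<in> carrier (mpoly_ring n) \<Longrightarrow> q \<in> carrier (mpoly_ring n) \<Longrightarrow> p * q \<in> carrier (mpoly_ring n)"
    and "p \<in> carrier (mpoly_ring n) \<Longrightarrow> q \<in> carrier (mpoly_ring n) \<Longrightarrow> p - q \<in> carrier (mpoly_ring n)"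
    and "Poly_Mapping.keys a \<subseteq> {1..n} \<Longrightarrow> Poly_Mapping.single a c \<in> carrier (mpoly_ring n :: 'a mpoly ring)"
proof -
  interpret ring "mpoly_ring n :: 'a mpoly ring" by (rule mpoly_ring_ring)
  show add: "p + q \<in> carrier (mpoly_ring n)"
    if "p \<in> carrier (mpoly_ring n)" "q \<in> carrier (mpoly_ring n)" for p q :: "'a mpoly"
    using add.m_closed[OF that] by simp
  show "p * q \<in> carrier (mpoly_ring n)"
    if "p \<in> carrier (mpoly_ring n)" "q \<in> carrier (mpoly_ring n)"
    using m_closed[OF that] by simp
  show "p - q \<in> carrier (mpoly_ring n)"
    if "p \<in> carrier (mpoly_ring n)" "q \<in> carrier (mpoly_ring n)"
    using add[OF that(1) mpoly_minus_closed[OF that(2)]] by simp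
  show "Poly_Mapping.keys a \<subseteq> {1..n} \<Longrightarrow> Poly_Mapping.single a c \<in> carrier (mpoly_ring n)"
    by (simp add: in_carrier_mpoly_ring_iff)
qed

lemma mpoly_ring_a_inv:
  assumes "p \<in> carrier (mpoly_ring n)"
  shows "\<ominus>\<^bsub>mpoly_ring n\<^esub> p = - (p :: 'a::field mpoly)"
proof -
  interpret ring "mpoly_ring n :: 'a mpoly ring" by (rule mpoly_ring_ring)
  show ?thesis
    by (rule minus_equality) (use assms mpoly_minus_closed in auto)
qed

lemma mpoly_idealI:
  fixes I :: "'a::field mpoly set"
  assumes "I \<subseteq> carrier (mpoly_ring n)" "0 \<in> I"
    and "\<And>p q. p \<in> I \<Longrightarrow> q \<in> I \<Longrightarrow> p + q \<in> I"
    and "\<And>p q. p \<in> carrier (mpoly_ring n) \<Longrightarrow> q \<in> I \<Longrightarrow> p * q \<in> I"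
  shows "ideal I (mpoly_ring n)"
proof -
  interpret ring "mpoly_ring n :: 'a mpoly ring" by (rule mpoly_ring_ring)
  have neg: "- p \<in> I" if "p \<in> I" for p
  proof -
    have "- 1 \<in> carrier (mpoly_ring n :: 'a mpoly ring)"
      using mpoly_minus_closed[OF one_closed] by simp
    then show ?thesis
      using assms(4)[of "- 1" p] that by simp
  qed
  show ?thesis
  proof (rule idealI)
    show "subgroup I (add_monoid (mpoly_ring n))"
    proof (rule add.subgroupI)
      fix p assume "p \<in> I"
      then show "\<ominus>\<^bsub>mpoly_ring n\<^esub> p \<in> I"
        using neg[of p] assms(1) by (auto simp: mpoly_ring_a_inv)
    qed (use assms in auto)
  next
    fix a x :: "'a mpoly"
    assume "a \<in> I" "x \<in> carrier (mpoly_ring n)"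
    then have "x * a \<in> I"
      by (intro assms(4))
    then show "x \<otimes>\<^bsub>mpoly_ring n\<^esub> a \<in> I" "a \<otimes>\<^bsub>mpoly_ring n\<^esub> x \<in> I"
      by (simp_all add: mult.commute)
  qed (rule mpoly_ring_ring)
qed

lemma mpoly_idealD:
  fixes I :: "'a::field mpoly set"
  assumes "ideal I (mpoly_ring n)"
  shows "0 \<in> I" "p \<in> I \<Longrightarrow> q \<in> I \<Longrightarrow> p + q \<in> I" "p \<in> I \<Longrightarrow> - p \<in> I"
    "p \<in> I \<Longrightarrow> q \<in> I \<Longrightarrow> p - q \<in> I"
    "r \<in> carrier (mpoly_ring n) \<Longrightarrow> p \<in> I \<Longrightarrow> r * p \<in> I"
proof -
  interpret ideal I "mpoly_ring n" by (rule assms)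
  show 0: "0 \<in> I" using additive_subgroup.zero_closed[OF is_additive_subgroup] by simp
  show add: "p + q \<in> I" if "p \<in> I" "q \<in> I" for p q using additive_subgroup.a_closed[OF is_additive_subgroup that] by simp
  show mult: "r * p \<in> I" if "r \<in> carrier (mpoly_ring n)" "p \<in> I" for r p
    using I_l_closed[OF that(2,1)] by simp
  show neg: "- p \<in> I" if "p \<in> I" for p
    using mult[of "- 1" p] mpoly_minus_closed[OF one_closed] that by simp
  show "p - q \<in> I" if "p \<in> I" "q \<in> I"
    using add[OF that(1) neg[OF that(2)]] by simp
qed

lemma ideal_genideal_mpoly:
  "S \<subseteq> carrier (mpoly_ring n) \<Longrightarrow> ideal (Idl\<^bsub>mpoly_ring n\<^esub> S) (mpoly_ring n :: 'a::field mpoly ring)"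
  by (rule ring.genideal_ideal[OF mpoly_ring_ring])

lemma mpoly_ideal_sumI:
  fixes I :: "'a::field mpoly set"
  assumes "ideal I (mpoly_ring n)" "\<And>x. x \<in> A \<Longrightarrow> f x \<in> I"
  shows "sum f A \<in> I"
  using assms(2) by (induction A rule: infinite_finite_induct)
    (auto intro: mpoly_idealD(1,2)[OF assms(1)])

section \<open>A lattice congruence on monomials\<close>

text \<open>For a monomial in \<open>x\<^sub>1, \<dots>, x\<^sub>n\<close> this says that it is \<open>x\<^sub>A
  x\<^sub>n\<^sup>m\<close> with \<open>A \<subseteq> {1..n-1}\<close> and \<open>m + 2|A| \<le> 2n - 4\<close>;
  these turn out to be the monomials outside the initial ideal.\<close>

definition standard :: "nat \<Rightarrow> (nat \<Rightarrow>\<^sub>0 nat) \<Rightarrow> bool" where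
  "standard n a \<longleftrightarrow> (\<forall>i\<in>{1..<n}. Poly_Mapping.lookup a i \<le> 1) \<and>
     Poly_Mapping.lookup a n + 2 * (\<Sum>i\<in>{1..<n}. Poly_Mapping.lookup a i) \<le> 2 * n - 4"

text \<open>Congruence of exponent vectors modulo the lattice spanned by the vectors \<open>(1,\<dots>,1) -
  2e\<^sub>i\<close> with \<open>1 \<le> i \<le> n\<close>: an integer combination with coefficients
  \<open>c\<^sub>i\<close> of sum \<open>s\<close> has the entries \<open>s - 2c\<^sub>i\<close>, and these are
  exactly the vectors whose entries all have the parity of \<open>s\<close> and whose sum is \<open>(n -
  2)s\<close>. The monomial \<open>1\<close> is kept apart, because it is the only one that does not vanish at
  the origin, which is a zero of \<open>I\<^sub>n\<close>.\<close>

definition lattice_cong :: "nat \<Rightarrow> (nat \<Rightarrow>\<^sub>0 nat) \<Rightarrow> (nat \<Rightarrow>\<^sub>0 nat) \<Rightarrow> bool" where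
  "lattice_cong n a b \<longleftrightarrow> (a = 0 \<longleftrightarrow> b = 0) \<and>
     (\<exists>s. int (mdeg a) - int (mdeg b) = (int n - 2) * s \<and>
       (\<forall>i\<in>{1..n}. even (int (Poly_Mapping.lookup a i) - int (Poly_Mapping.lookup b i) - s)))"

lemma lattice_cong_refl: "lattice_cong n a a"
  by (auto simp: lattice_cong_def intro!: exI[of _ 0])

lemma lattice_cong_sym: "lattice_cong n a b \<Longrightarrow> lattice_cong n b a"
proof -
  assume "lattice_cong n a b"
  then obtain s where s: "a = 0 \<longleftrightarrow> b = 0" "int (mdeg a) - int (mdeg b) = (int n - 2) * s"
    "\<forall>i\<in>{1..n}. even (int (Poly_Mapping.lookup a i) - int (Poly_Mapping.lookup b i) - s)"
    by (auto simp: lattice_cong_def)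
  have "int (mdeg b) - int (mdeg a) = (int n - 2) * (- s)"
    using s(2) by (simp add: algebra_simps)
  moreover have "even (int (Poly_Mapping.lookup b i) - int (Poly_Mapping.lookup a i) - (- s))"
    if "i \<in> {1..n}" for i
    using s(3) that by auto
  ultimately show ?thesis
    using s(1) unfolding lattice_cong_def by blast
qed

lemma lattice_cong_trans:
  assumes "lattice_cong n a b" "lattice_cong n b c"
  shows "lattice_cong n a c"
proof -
  obtain s where s: "a = 0 \<longleftrightarrow> b = 0" "int (mdeg a) - int (mdeg b) = (int n - 2) * s"
    "\<forall>i\<in>{1..n}. even (int (Poly_Mapping.lookup a i) - int (Poly_Mapping.lookup b i) - s)"
    using assms(1) by (auto simp: lattice_cong_def)
  obtain t where t: "b = 0 \<longleftrightarrow> c = 0" "int (mdeg b) - int (mdeg c) = (int n - 2) * t"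
    "\<forall>i\<in>{1..n}. even (int (Poly_Mapping.lookup b i) - int (Poly_Mapping.lookup c i) - t)"
    using assms(2) by (auto simp: lattice_cong_def)
  have "int (mdeg a) - int (mdeg c) = (int n - 2) * (s + t)"
    using s(2) t(2) by (simp add: algebra_simps)
  moreover have "even (int (Poly_Mapping.lookup a i) - int (Poly_Mapping.lookup c i) - (s + t))"
    if "i \<in> {1..n}" for i
  proof -
    have "even ((int (Poly_Mapping.lookup a i) - int (Poly_Mapping.lookup b i) - s) +
        (int (Poly_Mapping.lookup b i) - int (Poly_Mapping.lookup c i) - t))"
      using s(3) t(3) that by (intro dvd_add) auto
    then show ?thesis
      by (simp add: algebra_simps)
  qed
  ultimately show ?thesis
    using s(1) t(1) unfolding lattice_cong_def by blast
qed

lemma poly_mapping_add_eq_0_iff: "c + a = 0 \<longleftrightarrow> c = 0 \<and> a = (0 :: nat \<Rightarrow>\<^sub>0 nat)"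
  by (simp add: mdeg_eq_0_iff[symmetric] mdeg_add del: add_eq_0_iff_both_eq_0)

lemma lattice_cong_add:
  assumes "lattice_cong n a b"
  shows "lattice_cong n (c + a) (c + b)"
  using assms by (auto simp: lattice_cong_def poly_mapping_add_eq_0_iff mdeg_add lookup_add)

definition ones :: "nat set \<Rightarrow> (nat \<Rightarrow>\<^sub>0 nat)" where
  "ones S = (\<Sum>i\<in>S. Poly_Mapping.single i 1)"

lemma lookup_ones: "finite S \<Longrightarrow> Poly_Mapping.lookup (ones S) i = (if i \<in> S then 1 else 0)"
  by (simp add: ones_def lookup_sum lookup_single when_def)

lemma keys_ones [simp]: "finite S \<Longrightarrow> Poly_Mapping.keys (ones S) = S"
  by (auto simp: in_keys_iff lookup_ones split: if_splits)

lemma mdeg_ones [simp]: "mdeg (ones S) = card S"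
  by (simp add: ones_def mdeg_sum)

text \<open>The two monomials of the \<open>i\<close>-th generator differ by \<open>(1,\<dots>,1) -
  2e\<^sub>i\<close>, so that \<open>s = 1\<close>.\<close>

lemma lattice_cong_generator:
  assumes "n \<ge> 3" "i \<in> {1..n}"
  shows "lattice_cong n (ones ({1..n} - {i})) (Poly_Mapping.single i 1)"
proof -
  have "card ({1..n} - {i}) = n - 1"
    using assms by simp
  then have "int (mdeg (ones ({1..n} - {i}))) - int (mdeg (Poly_Mapping.single i (1::nat))) = (int n - 2) * 1"
    using assms(1) by simp
  moreover have "even (int (Poly_Mapping.lookup (ones ({1..n} - {i})) j) -
      int (Poly_Mapping.lookup (Poly_Mapping.single i 1) j) - 1)" if "j \<in> {1..n}" for j
    using that by (auto simp: lookup_ones lookup_single when_def)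
  moreover have "ones ({1..n} - {i}) \<noteq> 0"
    using \<open>card _ = _\<close> assms(1) by (simp flip: mdeg_eq_0_iff)
  moreover have "Poly_Mapping.single i (1::nat) \<noteq> 0"
    by (simp flip: mdeg_eq_0_iff)
  ultimately show ?thesis
    unfolding lattice_cong_def by blast
qed

lemma mdeg_split:
  assumes "Poly_Mapping.keys a \<subseteq> {1..n}" "n \<ge> 1"
  shows "mdeg a = Poly_Mapping.lookup a n + (\<Sum>i\<in>{1..<n}. Poly_Mapping.lookup a i)"
proof -
  have "mdeg a = (\<Sum>i\<in>{1..n}. Poly_Mapping.lookup a i)"
    using assms by (intro mdeg_eq_sum) auto
  moreover have "{1..n} = insert n {1..<n}"
    using assms(2) by auto
  ultimately show ?thesis
    by simp
qed

text \<open>Let \<open>b - a\<close> have sum \<open>(n - 2)s\<close> and entries of the parity of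
  \<open>s\<close>. For \<open>s > 0\<close> the degree of \<open>b\<close> is larger. For \<open>s = 0\<close>
  the exponents of \<open>a\<close> before the last are the least ones of their parity, so \<open>b\<close>
  differs from \<open>a\<close> only if its last exponent is smaller, which makes it larger in GRevLex. For
  \<open>s = -1\<close> the indices below \<open>n\<close> outside the support of \<open>a\<close> are in that
  of \<open>b\<close>, for which the bound on the last exponent of \<open>a\<close> leaves \<open>b\<close> too
  small a degree. For \<open>s \<le> -2\<close> that bound forces \<open>b\<close> to be the monomial
  \<open>1\<close>; then \<open>a\<close> is \<open>1\<close> as well, and the degrees do not fit.\<close>

lemma standard_minimal:
  assumes "n \<ge> 3" "standard n a" "lattice_cong n b a"
    and a: "Poly_Mapping.keys a \<subseteq> {1..n}" and b: "Poly_Mapping.keys b \<subseteq> {1..n}"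
  shows "b = a \<or> grevlex_less a b"
proof -
  let ?a = "Poly_Mapping.lookup a" and ?b = "Poly_Mapping.lookup b"
  obtain s where zero: "b = 0 \<longleftrightarrow> a = 0" and s: "int (mdeg b) - int (mdeg a) = (int n - 2) * s"
    and parity: "\<And>i. i \<in> {1..n} \<Longrightarrow> even (int (?b i) - int (?a i) - s)"
    using assms(3) unfolding lattice_cong_def by blast
  have std: "\<And>i. i \<in> {1..<n} \<Longrightarrow> ?a i \<le> 1" "?a n + 2 * (\<Sum>i\<in>{1..<n}. ?a i) \<le> 2 * n - 4"
    using assms(2) by (auto simp: standard_def)
  have dega: "mdeg a = ?a n + (\<Sum>i\<in>{1..<n}. ?a i)" and degb: "mdeg b = ?b n + (\<Sum>i\<in>{1..<n}. ?b i)"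
    using mdeg_split a b assms(1) by auto
  consider "s > 0" | "s = 0" | "s = - 1" | "s \<le> - 2"
    by linarith
  then show ?thesis
  proof cases
    case 1
    then have "(int n - 2) * s > 0"
      using assms(1) by simp
    then have "mdeg a < mdeg b"
      using s by linarith
    then show ?thesis
      by (simp add: grevlex_less_def)
  next
    case 2
    then have deg: "mdeg a = mdeg b"
      using s by simp
    have le: "?a i \<le> ?b i" if "i \<in> {1..<n}" for i
      using parity[of i] std(1)[of i] that 2 by (cases "?b i = 0") auto
    then have sum_le: "(\<Sum>i\<in>{1..<n}. ?a i) \<le> (\<Sum>i\<in>{1..<n}. ?b i)"
      by (rule sum_mono)
    have above: "?a j = ?b j" if "j > n" for j
    proof -
      have "j \<notin> Poly_Mapping.keys a" "j \<notin> Poly_Mapping.keys b"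
        using a b that by auto
      then show ?thesis
        by (simp add: in_keys_iff)
    qed
    show ?thesis
    proof (cases "?b n < ?a n")
      case True
      then show ?thesis
        using deg above by (auto simp: grevlex_less_def)
    next
      case False
      then have eq: "?a n = ?b n" "(\<Sum>i\<in>{1..<n}. ?a i) = (\<Sum>i\<in>{1..<n}. ?b i)"
        using deg dega degb sum_le by linarith+
      have "?a i = ?b i" if "i \<in> {1..<n}" for i
        using sum_mono_inv[OF eq(2) le that] by simp
      moreover have "?a 0 = ?b 0"
      proof -
        have "0 \<notin> Poly_Mapping.keys a" "0 \<notin> Poly_Mapping.keys b"
          using a b by auto
        then show ?thesis
          by (simp add: in_keys_iff)
      qed
      ultimately have "?a i = ?b i" for i
        using eq(1) above[of i] by (cases "i = 0"; cases "i = n"; cases "i > n") auto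
      then show ?thesis
        by (auto intro: poly_mapping_eqI)
    qed
  next
    case 3
    \<comment> \<open>every exponent below \<open>n\<close> changes parity\<close>
    have "1 \<le> ?b i + ?a i" if "i \<in> {1..<n}" for i
      using parity[of i] that 3 by (cases "?b i = 0"; cases "?a i = 0") auto
    then have "(\<Sum>i\<in>{1..<n}. 1) \<le> (\<Sum>i\<in>{1..<n}. ?b i + ?a i)"
      by (rule sum_mono)
    then have "n - 1 \<le> (\<Sum>i\<in>{1..<n}. ?b i) + (\<Sum>i\<in>{1..<n}. ?a i)"
      by (simp add: sum.distrib)
    moreover have "int (mdeg b) = int (mdeg a) - int n + 2"
      using s 3 by simp
    ultimately have False
      using std(2) dega degb assms(1) by linarith
    then show ?thesis ..
  next
    case 4
    have "(int n - 2) * s \<le> (int n - 2) * (- 2)"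
      using 4 assms(1) by (intro mult_left_mono) auto
    then have "int (mdeg b) \<le> int (mdeg a) - 2 * int n + 4"
      using s by simp
    then have "mdeg b = 0" "mdeg a + (\<Sum>i\<in>{1..<n}. ?a i) = 2 * n - 4"
      using std(2) dega assms(1) by linarith+
    then have "a = 0"
      using zero by (simp add: mdeg_eq_0_iff)
    then have False
      using \<open>mdeg a + _ = _\<close> assms(1) by simp
    then show ?thesis ..
  qed
qed

section \<open>Leading monomials are not standard\<close>

text \<open>The linear functional on polynomials with the values \<open>\<phi>\<close> on monomials. Class
  functions \<open>\<phi>\<close> are used instead of the sum over one class, because multiplication by a
  monomial carries a class function to a class function but need not carry a class to a class.\<close>

definition pairing :: "('x \<Rightarrow> 'a) \<Rightarrow> ('x \<Rightarrow>\<^sub>0 'a) \<Rightarrow> 'a::field" where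
  "pairing \<phi> p = (\<Sum>a\<in>Poly_Mapping.keys p. Poly_Mapping.lookup p a * \<phi> a)"

lemma pairing_add: "pairing \<phi> (p + q) = pairing \<phi> p + pairing \<phi> q"
  unfolding pairing_def by (rule setsum_keys_plus_distrib) (auto simp: distrib_right)

lemma pairing_zero [simp]: "pairing \<phi> 0 = 0"
  by (simp add: pairing_def)

lemma pairing_single [simp]: "pairing \<phi> (Poly_Mapping.single a c) = c * \<phi> a"
  by (simp add: pairing_def)

lemma pairing_diff: "pairing \<phi> (p - q) = pairing \<phi> p - pairing \<phi> q"
  using pairing_add[of \<phi> "p - q" q] by simp

lemma pairing_single_mult:
  "pairing \<phi> (Poly_Mapping.single c k * p) = k * pairing (\<lambda>a. \<phi> (c + a)) p"
  by (induction p rule: poly_mapping_induct_add)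
     (auto simp: pairing_add mult_single distrib_left)

lemma prod_var_eq_single: "(\<Prod>j\<in>S. var j) = (Poly_Mapping.single (ones S) 1 :: 'a::field mpoly)"
  by (induction S rule: infinite_finite_induct) (auto simp: ones_def var_def mult_single)

lemma I_ideal_eq:
  "n \<ge> 3 \<Longrightarrow> I_ideal n = Idl\<^bsub>mpoly_ring n\<^esub>
     {Poly_Mapping.single (ones ({1..n} - {i})) 1 - Poly_Mapping.single (Poly_Mapping.single i 1) 1 | i. i \<in> {1..n}}"
  by (simp add: I_ideal_def prod_var_eq_single) (simp add: var_def)

lemma I_generators_carrier:
  assumes "n \<ge> 2"
  shows "(if n = 2 then {var 1, var 2}
      else {(\<Prod>j \<in> {1..n} - {i}. var j) - var i | i. i \<in> {1..n}}) \<subseteq> carrier (mpoly_ring n :: 'a::field mpoly ring)"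
  using assms unfolding prod_var_eq_single
  by (auto simp: var_def intro!: mpoly_carrier_closed)

lemma ideal_I_ideal: "n \<ge> 2 \<Longrightarrow> ideal (I_ideal n) (mpoly_ring n :: 'a::field mpoly ring)"
  unfolding I_ideal_def by (rule ideal_genideal_mpoly[OF I_generators_carrier])

text \<open>The polynomials annihilated by all class functions form an ideal, since a class function precomposed
  with a translation of exponents is one again, and this ideal contains the generators of
  \<open>I\<^sub>n\<close>.\<close>

lemma pairing_I_ideal:
  fixes p :: "'a::field mpoly"
  assumes "n \<ge> 3" "p \<in> I_ideal n" and \<phi>: "\<And>a b. lattice_cong n a b \<Longrightarrow> \<phi> a = \<phi> b"
  shows "pairing \<phi> p = 0"
proof -
  define K :: "'a mpoly set" where
    "K = {p \<in> carrier (mpoly_ring n).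
       \<forall>\<phi>. (\<forall>a b. lattice_cong n a b \<longrightarrow> \<phi> a = \<phi> b) \<longrightarrow> pairing \<phi> p = 0}"
  have KD: "pairing \<phi> p = 0"
    if "p \<in> K" "\<forall>a b. lattice_cong n a b \<longrightarrow> \<phi> a = \<phi> b" for p \<phi>
    using that by (simp add: K_def)
  have mult: "pairing \<phi> (r * p) = 0"
    if "p \<in> K" and \<phi>: "\<forall>a b. lattice_cong n a b \<longrightarrow> \<phi> a = \<phi> b" for r p :: "'a mpoly" and \<phi>
  proof (induction r rule: poly_mapping_induct_add)
    case (single c k)
    have "\<forall>a b. lattice_cong n a b \<longrightarrow> \<phi> (c + a) = \<phi> (c + b)"
      using \<phi> lattice_cong_add[of n _ _ c] by simp
    from KD[OF \<open>p \<in> K\<close> this] show ?case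
      by (simp add: pairing_single_mult)
  qed (auto simp: distrib_right pairing_add)
  have "ideal K (mpoly_ring n)"
  proof (rule mpoly_idealI)
    show "p * q \<in> K" if "p \<in> carrier (mpoly_ring n)" "q \<in> K" for p q
      using mult[OF that(2)] mpoly_carrier_closed(2)[OF that(1)] that(2) by (simp add: K_def)
    show "0 \<in> K"
      by (simp add: K_def in_carrier_mpoly_ring_iff)
  qed (auto simp: K_def pairing_add mpoly_carrier_closed)
  moreover have "Poly_Mapping.single (ones ({1..n} - {i})) 1 -
      Poly_Mapping.single (Poly_Mapping.single i 1) 1 \<in> K" if "i \<in> {1..n}" for i
    using lattice_cong_generator[OF assms(1) that] that
    by (auto simp: K_def pairing_diff intro!: mpoly_carrier_closed)
  ultimately have "I_ideal n \<subseteq> K"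
    unfolding I_ideal_eq[OF assms(1)] by (intro ring.genideal_minimal[OF mpoly_ring_ring]) auto
  then have "p \<in> K"
    using assms(2) by blast
  then show ?thesis
    using \<phi> by (intro KD) auto
qed

text \<open>Pair \<open>f\<close> with the indicator function of the class of its leading monomial. If the
  latter is standard, minimality in the class leaves no other monomial of \<open>f\<close> in this class, and
  the pairing is the leading coefficient. For \<open>n = 2\<close> the only standard monomial is
  \<open>1\<close>, and elements of the ideal have no constant term.\<close>

lemma lead_monomial_not_standard:
  fixes f :: "'a::field mpoly"
  assumes "n \<ge> 2" "f \<in> I_ideal n" "f \<noteq> 0"
  shows "\<not> standard n (lead_monomial f)"
proof
  assume std: "standard n (lead_monomial f)"
  let ?a = "lead_monomial f"
  have carr: "f \<in> carrier (mpoly_ring n)"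
    using additive_subgroup.a_subset[OF ideal.axioms(1)[OF ideal_I_ideal[OF assms(1)]]] assms(2) by blast
  note lm = lead_monomial[OF assms(3)]
  have keys: "Poly_Mapping.keys b \<subseteq> {1..n}" if "b \<in> Poly_Mapping.keys f" for b
    using carr that by (auto simp: in_carrier_mpoly_ring_iff)
  show False
  proof (cases "n = 2")
    case False
    then have n: "n \<ge> 3"
      using assms(1) by simp
    define \<phi> where "\<phi> b = (if lattice_cong n b ?a then 1 else (0::'a))" for b
    have "\<phi> b = 0" if "b \<in> Poly_Mapping.keys f" "b \<noteq> ?a" for b
    proof -
      have "\<not> grevlex_less ?a b"
        using lm(2)[OF that] grevlex_trans[of b ?a b] grevlex_irrefl[of b] by auto
      then have "\<not> lattice_cong n b ?a"
        using standard_minimal[OF n std _ keys[OF lm(1)] keys[OF that(1)]] that(2) by auto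
      then show ?thesis
        by (simp add: \<phi>_def)
    qed
    then have "pairing \<phi> f = (\<Sum>b\<in>{?a}. Poly_Mapping.lookup f b * \<phi> b)"
      unfolding pairing_def using lm(1) by (intro sum.mono_neutral_right) auto
    also have "\<dots> = Poly_Mapping.lookup f ?a"
      by (simp add: \<phi>_def lattice_cong_refl)
    also have "\<dots> \<noteq> 0"
      using lm(1) by (simp add: in_keys_iff)
    finally have "pairing \<phi> f \<noteq> 0" .
    moreover have "\<phi> a = \<phi> b" if "lattice_cong n a b" for a b
    proof -
      have "lattice_cong n a ?a \<longleftrightarrow> lattice_cong n b ?a"
        using that lattice_cong_trans[of n a b ?a] lattice_cong_trans[of n b a ?a]
          lattice_cong_sym[of n a b] by auto
      then show ?thesis
        by (simp add: \<phi>_def)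
    qed
    ultimately show False
      using pairing_I_ideal[OF n assms(2)] by blast
  next
    case True
    have "?a = 0"
      using std mdeg_split[OF keys[OF lm(1)]] assms(1) True
      by (auto simp: standard_def simp flip: mdeg_eq_0_iff)
    define K :: "'a mpoly set" where "K = {p \<in> carrier (mpoly_ring 2). Poly_Mapping.lookup p 0 = 0}"
    have mult: "Poly_Mapping.lookup (r * p) 0 = 0" if "p \<in> K" for r p :: "'a mpoly"
    proof -
      have "0 \<notin> Poly_Mapping.keys (r * p)"
      proof
        assume "0 \<in> Poly_Mapping.keys (r * p)"
        then obtain b c where "0 = b + c" "c \<in> Poly_Mapping.keys p"
          using keys_mult[of r p] by blast
        then have "0 \<in> Poly_Mapping.keys p"
          using poly_mapping_add_eq_0_iff[of b c] by simp
        then show False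
          using that by (simp add: K_def in_keys_iff)
      qed
      then show ?thesis
        by (simp add: in_keys_iff)
    qed
    have "ideal K (mpoly_ring 2)"
      by (rule mpoly_idealI)
         (use mult in \<open>auto simp: K_def lookup_add mpoly_carrier_closed in_carrier_mpoly_ring_iff[of 0]\<close>)
    moreover have "var 1 \<in> K" "var 2 \<in> K"
      by (auto simp: K_def var_def lookup_single when_def mpoly_carrier_closed simp flip: mdeg_eq_0_iff)
    ultimately have "I_ideal 2 \<subseteq> K"
      unfolding I_ideal_def by (intro ring.genideal_minimal[OF mpoly_ring_ring]) auto
    then have "Poly_Mapping.lookup f 0 = 0"
      using assms(2) True by (auto simp: K_def)
    with lm(1) \<open>?a = 0\<close> show False
      by (simp add: in_keys_iff)
  qed
qed

section \<open>Nonstandard monomials are leading monomials\<close>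

text \<open>Turns the pointwise conditions in \<open>standard\<close> into the form \<open>x\<^sub>S
  x\<^sub>n\<^sup>m\<close>.\<close>

lemma squarefree_decomposition:
  assumes keys: "Poly_Mapping.keys a \<subseteq> {1..n}"
    and le: "\<forall>i\<in>{1..<n}. Poly_Mapping.lookup a i \<le> 1"
    and S: "S = {i\<in>{1..<n}. Poly_Mapping.lookup a i = 1}"
  shows "a = ones S + Poly_Mapping.single n (Poly_Mapping.lookup a n)"
    and "(\<Sum>i\<in>{1..<n}. Poly_Mapping.lookup a i) = card S"
proof -
  have lookup_le: "Poly_Mapping.lookup a i = (if i \<in> S then 1 else 0)" if "i \<in> {1..<n}" for i
    using le that by (auto simp: S le_Suc_eq)
  show "a = ones S + Poly_Mapping.single n (Poly_Mapping.lookup a n)"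
  proof (rule poly_mapping_eqI)
    fix i
    have "Poly_Mapping.lookup a i = 0" if "i \<notin> {1..n}"
      using keys that by (auto simp: in_keys_iff)
    then show "Poly_Mapping.lookup a i =
        Poly_Mapping.lookup (ones S + Poly_Mapping.single n (Poly_Mapping.lookup a n)) i"
      using lookup_le[of i]
      by (cases "i = n"; cases "i \<in> {1..<n}")
         (auto simp: lookup_add lookup_ones lookup_single when_def S)
  qed
  have "(\<Sum>i\<in>{1..<n}. Poly_Mapping.lookup a i) = (\<Sum>i\<in>{1..<n}. if i \<in> S then 1 else 0)"
    using lookup_le by (intro sum.cong) auto
  also have "\<dots> = card ({1..<n} \<inter> S)"
    by (simp add: sum.inter_restrict[symmetric])
  also have "{1..<n} \<inter> S = S"
    by (auto simp: S)
  finally show "(\<Sum>i\<in>{1..<n}. Poly_Mapping.lookup a i) = card S" .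
qed

lemma keys_add_subsetI:
  "Poly_Mapping.keys a \<subseteq> A \<Longrightarrow> Poly_Mapping.keys b \<subseteq> A \<Longrightarrow> Poly_Mapping.keys (a + b) \<subseteq> A"
  using Poly_Mapping.keys_add[of a b] by blast

definition binomial_cong :: "'a::field mpoly set \<Rightarrow> (nat \<Rightarrow>\<^sub>0 nat) \<Rightarrow> (nat \<Rightarrow>\<^sub>0 nat) \<Rightarrow> bool" where
  "binomial_cong I a b \<longleftrightarrow> Poly_Mapping.single a 1 - Poly_Mapping.single b 1 \<in> I"

context
  fixes n :: nat and I :: "'a::field mpoly set"
  assumes ideal_I: "ideal I (mpoly_ring n)"
begin

lemma binomial_cong_refl: "binomial_cong I a a"
  using mpoly_idealD(1)[OF ideal_I] by (simp add: binomial_cong_def)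

lemma binomial_cong_sym: "binomial_cong I a b \<Longrightarrow> binomial_cong I b a"
  using mpoly_idealD(3)[OF ideal_I, of "Poly_Mapping.single a 1 - Poly_Mapping.single b 1"]
  by (simp add: binomial_cong_def)

lemma binomial_cong_trans: "binomial_cong I a b \<Longrightarrow> binomial_cong I b c \<Longrightarrow> binomial_cong I a c"
  using mpoly_idealD(2)[OF ideal_I, of "Poly_Mapping.single a 1 - Poly_Mapping.single b 1"
      "Poly_Mapping.single b 1 - Poly_Mapping.single c 1"]
  by (simp add: binomial_cong_def)

lemma binomial_cong_add:
  assumes "Poly_Mapping.keys c \<subseteq> {1..n}" "binomial_cong I a b"
  shows "binomial_cong I (c + a) (c + b)"
proof -
  have "Poly_Mapping.single c 1 * (Poly_Mapping.single a 1 - Poly_Mapping.single b 1) \<in> I"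
    using assms mpoly_carrier_closed(4) by (intro mpoly_idealD(5)[OF ideal_I]) (auto simp: binomial_cong_def)
  then show ?thesis
    by (simp add: binomial_cong_def right_diff_distrib mult_single)
qed

context
  assumes gen: "\<And>i. i \<in> {1..n} \<Longrightarrow> binomial_cong I (ones ({1..n} - {i})) (Poly_Mapping.single i 1)"
begin

lemma ones_remove: "finite S \<Longrightarrow> i \<in> S \<Longrightarrow> ones S = Poly_Mapping.single i 1 + ones (S - {i})"
  unfolding ones_def by (rule sum.remove)

text \<open>Multiplying the \<open>i\<close>-th generator by \<open>x\<^sub>i\<close> shows that
  \<open>x\<^sub>i\<^sup>2\<close> is congruent to the product of all variables, whatever \<open>i\<close>
  is.\<close>

lemma square_cong:
  assumes "i \<in> {1..n}" "j \<in> {1..n}"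
  shows "binomial_cong I (Poly_Mapping.single i 2) (Poly_Mapping.single j 2)"
proof -
  have *: "binomial_cong I (ones {1..n}) (Poly_Mapping.single i 2)" if "i \<in> {1..n}" for i
  proof -
    have "binomial_cong I (Poly_Mapping.single i 1 + ones ({1..n} - {i}))
        (Poly_Mapping.single i 1 + Poly_Mapping.single i 1)"
      using that by (intro binomial_cong_add gen) auto
    moreover have "Poly_Mapping.single i 1 + Poly_Mapping.single i 1 = Poly_Mapping.single i (2::nat)"
      by (simp add: single_add[symmetric] numeral_2_eq_2)
    ultimately show ?thesis
      using that ones_remove[of "{1..n}" i] by simp
  qed
  show ?thesis
    by (rule binomial_cong_trans[OF binomial_cong_sym[OF *[OF assms(1)]] *[OF assms(2)]])
qed

lemma squares_cong:
  assumes "n \<ge> 1" "S \<subseteq> {1..n}"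
  shows "binomial_cong I (ones S + ones S) (Poly_Mapping.single n (2 * card S))"
  using finite_subset[OF assms(2) finite_atLeastAtMost] assms(2)
proof (induction S rule: finite_induct)
  case (insert i S)
  have fin: "finite S"
    using insert by simp
  have "binomial_cong I ((ones S + ones S) + Poly_Mapping.single i 2) ((ones S + ones S) + Poly_Mapping.single n 2)"
    using insert.prems assms(1) fin
    by (intro binomial_cong_add square_cong keys_add_subsetI) auto
  moreover have "binomial_cong I (Poly_Mapping.single n 2 + (ones S + ones S))
      (Poly_Mapping.single n 2 + Poly_Mapping.single n (2 * card S))"
    using insert assms(1) by (intro binomial_cong_add) auto
  ultimately have "binomial_cong I ((ones S + ones S) + Poly_Mapping.single i 2)
      (Poly_Mapping.single n 2 + Poly_Mapping.single n (2 * card S))"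
    unfolding add.commute[of "Poly_Mapping.single n 2" "ones S + ones S"] by (rule binomial_cong_trans)
  moreover have "ones (insert i S) + ones (insert i S) = (ones S + ones S) + Poly_Mapping.single i 2"
  proof -
    have "Poly_Mapping.single i 2 = Poly_Mapping.single i 1 + Poly_Mapping.single i (1::nat)"
      by (simp add: single_add[symmetric] numeral_2_eq_2)
    then show ?thesis
      using insert.hyps by (simp add: ones_def ac_simps)
  qed
  moreover have "Poly_Mapping.single n 2 + Poly_Mapping.single n (2 * card S) =
      Poly_Mapping.single n (2 * card (insert i S))"
    using insert.hyps by (simp add: single_add[symmetric])
  ultimately show ?case
    by simp
qed (simp add: ones_def binomial_cong_refl)

text \<open>For \<open>i \<in> T\<close> and \<open>U = T - {i}\<close>, replace
  \<open>x\<^sub>n\<^bsup>2|U|\<^esup>\<close> by \<open>x\<^sub>U\<^sup>2\<close>. One factor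
  \<open>x\<^sub>U\<close> completes \<open>x\<^sub>S x\<^sub>n\<close> to the product of all variables except
  \<open>x\<^sub>i\<close>, which is congruent to \<open>x\<^sub>i\<close>; the other factor turns this into
  \<open>x\<^sub>T\<close>.\<close>

lemma complement_cong:
  assumes "n \<ge> 1" "S \<subseteq> {1..<n}" "T = {1..<n} - S" "T \<noteq> {}"
  shows "binomial_cong I (ones S + Poly_Mapping.single n (2 * card T - 1)) (ones T)"
proof -
  obtain i where i: "i \<in> T"
    using assms(4) by blast
  have fin: "finite S" "finite T"
    using assms(2,3) by (auto intro: finite_subset)
  let ?U = "T - {i}" and ?c = "ones S + Poly_Mapping.single n 1"
  have card: "2 * card T - 1 = 1 + 2 * card ?U"
    using card.remove[OF fin(2) i] by simp
  have lhs: "ones S + Poly_Mapping.single n (2 * card T - 1) = ?c + Poly_Mapping.single n (2 * card ?U)"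
    by (simp only: card single_add add.assoc)
  have 1: "binomial_cong I (?c + Poly_Mapping.single n (2 * card ?U)) (?c + (ones ?U + ones ?U))"
  proof (rule binomial_cong_add)
    show "Poly_Mapping.keys ?c \<subseteq> {1..n}"
      using fin assms(1,2) by (intro keys_add_subsetI) auto
    show "binomial_cong I (Poly_Mapping.single n (2 * card ?U)) (ones ?U + ones ?U)"
      using assms by (intro binomial_cong_sym[OF squares_cong]) auto
  qed
  have mid: "?c + (ones ?U + ones ?U) = ones ?U + ones ({1..n} - {i})"
  proof -
    have "ones S + ones ?U + Poly_Mapping.single n 1 = ones ({1..n} - {i})"
      using i assms(1,2) fin unfolding assms(3)
      by (intro poly_mapping_eqI) (auto simp: lookup_add lookup_ones lookup_single when_def)
    then show ?thesis
      by (simp add: ac_simps)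
  qed
  have 2: "binomial_cong I (ones ?U + ones ({1..n} - {i})) (ones ?U + Poly_Mapping.single i 1)"
    using i fin assms(3) by (intro binomial_cong_add gen) auto
  have rhs: "ones ?U + Poly_Mapping.single i 1 = ones T"
    using ones_remove[OF fin(2) i] by (simp add: add.commute)
  show ?thesis
    unfolding lhs by (rule binomial_cong_trans[OF 1[unfolded mid] 2[unfolded rhs]])
qed

text \<open>A square \<open>x\<^sub>i\<^sup>2\<close> with \<open>i < n\<close> can be traded for
  \<open>x\<^sub>n\<^sup>2\<close>, which is smaller in GRevLex. Otherwise the monomial is \<open>x\<^sub>S
  x\<^sub>n\<^sup>m\<close> with \<open>m > 2n - 4 - 2|S|\<close>, so with \<open>T\<close> the complement of
  \<open>S\<close> it is divisible by \<open>x\<^sub>S x\<^sub>n\<^bsup>2|T|-1\<^esup>\<close> (if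
  \<open>T\<close> is nonempty) or by \<open>x\<^sub>1 \<cdots> x\<^bsub>n-1\<^esub>\<close>; in both cases the
  degree drops by \<open>n - 2\<close>.\<close>

lemma nonstandard_reducible:
  assumes "n \<ge> 3" "\<not> standard n a" and keys: "Poly_Mapping.keys a \<subseteq> {1..n}"
  shows "\<exists>b. binomial_cong I a b \<and> grevlex_less b a"
proof (cases "\<forall>i\<in>{1..<n}. Poly_Mapping.lookup a i \<le> 1")
  case False
  then obtain i where i: "i \<in> {1..<n}" "Poly_Mapping.lookup a i \<ge> 2"
    by force
  define c where "c = a - Poly_Mapping.single i 2"
  have a: "a = c + Poly_Mapping.single i 2"
    using i(2) by (intro poly_mapping_eqI) (auto simp: c_def lookup_add lookup_minus lookup_single when_def)
  have "Poly_Mapping.keys c \<subseteq> {1..n}"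
    using keys by (auto simp: c_def in_keys_iff lookup_minus)
  then have "binomial_cong I a (c + Poly_Mapping.single n 2)"
    unfolding a using i assms(1) by (intro binomial_cong_add square_cong) auto
  moreover have "grevlex_less (c + Poly_Mapping.single n 2) a"
    unfolding grevlex_less_def a using i(1)
    by (auto simp: mdeg_add lookup_add lookup_single when_def intro!: exI[of _ n])
  ultimately show ?thesis
    by blast
next
  case True
  define S where "S = {i\<in>{1..<n}. Poly_Mapping.lookup a i = 1}"
  define m where "m = Poly_Mapping.lookup a n"
  have fin: "finite S"
    by (simp add: S_def)
  have a: "a = ones S + Poly_Mapping.single n m"
    unfolding m_def by (rule squarefree_decomposition(1)[OF keys True S_def])
  have m: "m + 2 * card S > 2 * n - 4"
    using assms(2) True squarefree_decomposition(2)[OF keys True S_def] by (simp add: standard_def m_def)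
  show ?thesis
  proof (cases "S = {1..<n}")
    case True
    have "{1..n} - {n} = S"
      using True by auto
    then have "binomial_cong I (Poly_Mapping.single n m + ones S) (Poly_Mapping.single n m + Poly_Mapping.single n 1)"
      using gen[of n] assms(1) by (intro binomial_cong_add) auto
    moreover have "grevlex_less (Poly_Mapping.single n m + Poly_Mapping.single n 1) a"
    proof -
      have "card S = n - 1"
        by (simp add: True)
      then have "m + 1 < card S + m"
        using assms(1) by linarith
      then show ?thesis
        by (simp add: grevlex_less_def a mdeg_add)
    qed
    ultimately show ?thesis
      unfolding a by (auto simp: add.commute)
  next
    case False
    define T where "T = {1..<n} - S"
    have S: "S \<subseteq> {1..<n}"
      by (auto simp: S_def)
    have T: "T \<noteq> {}"
      using False S by (auto simp: T_def)
    have "card S + card T = n - 1"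
      using S fin card_mono[OF _ S] by (simp add: T_def card_Diff_subset)
    moreover have "card T \<ge> 1"
      using T by (simp add: T_def Suc_le_eq card_gt_0_iff)
    ultimately have le: "2 * card T - 1 \<le> m" "card T < card S + (2 * card T - 1)"
      using m assms(1) by linarith+
    let ?c = "Poly_Mapping.single n (m - (2 * card T - 1))"
    have "a = ?c + (ones S + Poly_Mapping.single n (2 * card T - 1))"
      using le(1) by (simp add: a ac_simps single_add[symmetric])
    moreover have "binomial_cong I (?c + (ones S + Poly_Mapping.single n (2 * card T - 1))) (?c + ones T)"
      using assms(1) S T by (intro binomial_cong_add complement_cong) (auto simp: T_def)
    ultimately have "binomial_cong I a (?c + ones T)"
      by simp
    moreover have "grevlex_less (?c + ones T) a"
    proof -
      have "m - (2 * card T - 1) + card T < card S + m"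
        using le by linarith
      then show ?thesis
        by (simp add: grevlex_less_def mdeg_add a)
    qed
    ultimately show ?thesis
      by blast
  qed
qed

end

end

text \<open>For \<open>n = 2\<close> the ideal is generated by the two variables, so it contains every monomial
  except \<open>1\<close>.\<close>

lemma nonstandard_is_lead_monomial:
  assumes "n \<ge> 2" "\<not> standard n a" and keys: "Poly_Mapping.keys a \<subseteq> {1..n}"
  shows "\<exists>f\<in>I_ideal n :: 'a::field mpoly set. f \<noteq> 0 \<and> lead_monomial f = a"
proof (cases "n = 2")
  case False
  then have n: "n \<ge> 3"
    using assms(1) by simp
  have gen: "binomial_cong (I_ideal n :: 'a mpoly set) (ones ({1..n} - {i})) (Poly_Mapping.single i 1)"
    if "i \<in> {1..n}" for i
    unfolding binomial_cong_def I_ideal_eq[OF n]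
    by (rule ring.genideal_self[OF mpoly_ring_ring, THEN subsetD])
       (use that in \<open>auto intro!: mpoly_carrier_closed\<close>)
  obtain b where b: "binomial_cong (I_ideal n :: 'a mpoly set) a b" "grevlex_less b a"
    using nonstandard_reducible[OF ideal_I_ideal[OF assms(1)] gen n assms(2) keys] by blast
  let ?f = "Poly_Mapping.single a 1 - Poly_Mapping.single b 1 :: 'a mpoly"
  have "a \<noteq> b"
    using b(2) grevlex_irrefl[of a] by auto
  then have "Poly_Mapping.lookup ?f a \<noteq> 0"
    by (simp add: lookup_minus lookup_single)
  then have "?f \<noteq> 0"
    by (metis lookup_zero)
  then show ?thesis
    using b lead_monomial_binomial[OF b(2)] unfolding binomial_cong_def by blast
next
  case True
  have "a \<noteq> 0"
    using assms(2) True by (auto simp: standard_def)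
  then obtain i where i: "i \<in> Poly_Mapping.keys a"
    by (metis all_not_in_conv keys_eq_empty)
  define c where "c = a - Poly_Mapping.single i 1"
  have a: "a = c + Poly_Mapping.single i 1"
    using i by (intro poly_mapping_eqI)
      (auto simp: c_def lookup_add lookup_minus lookup_single when_def in_keys_iff)
  have "Poly_Mapping.keys c \<subseteq> {1..n}"
    using keys by (auto simp: c_def in_keys_iff lookup_minus)
  then have "Poly_Mapping.single c 1 \<in> carrier (mpoly_ring n :: 'a mpoly ring)"
    by (intro mpoly_carrier_closed)
  moreover have "var i \<in> (I_ideal n :: 'a mpoly set)"
  proof -
    have "i = 1 \<or> i = 2"
      using i keys True by auto
    then show ?thesis
      unfolding I_ideal_def
      by (intro ring.genideal_self[OF mpoly_ring_ring I_generators_carrier, THEN subsetD])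
         (auto simp: True)
  qed
  ultimately have "Poly_Mapping.single c 1 * var i \<in> (I_ideal n :: 'a mpoly set)"
    by (rule mpoly_idealD(5)[OF ideal_I_ideal[OF assms(1)]])
  then have "Poly_Mapping.single a 1 \<in> (I_ideal n :: 'a mpoly set)"
    by (simp add: var_def mult_single a)
  moreover have "lead_monomial (Poly_Mapping.single a (1::'a)) = a"
    by (rule lead_monomial_eqI) auto
  moreover have "Poly_Mapping.single a (1::'a) \<noteq> 0"
    by (metis keys_single keys_zero insert_not_empty one_neq_zero)
  ultimately show ?thesis
    by blast
qed

section \<open>The initial ideal\<close>

lemma standard_add: "standard n (b + c) \<Longrightarrow> standard n c"
  by (force simp: standard_def lookup_add sum.distrib)

text \<open>The polynomials all of whose monomials are nonstandard form an ideal, since divisors of standard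
  monomials are standard. It contains the generators of \<open>J\<^sub>n\<close>, and each of its monomials is a
  leading monomial of an element of \<open>I\<^sub>n\<close>.\<close>

lemma J_ideal_eq:
  assumes "n \<ge> 2"
  shows "J_ideal n = {p \<in> carrier (mpoly_ring n :: 'a::field mpoly ring). \<forall>a\<in>Poly_Mapping.keys p. \<not> standard n a}"
    (is "_ = ?N")
    and ideal_J_ideal: "ideal (J_ideal n) (mpoly_ring n :: 'a::field mpoly ring)"
proof -
  let ?G = "{Poly_Mapping.single (lead_monomial f) (1::'a) | f :: 'a mpoly. f \<in> I_ideal n \<and> f \<noteq> 0}"
  have carr: "I_ideal n \<subseteq> carrier (mpoly_ring n :: 'a mpoly ring)"
    using additive_subgroup.a_subset[OF ideal.axioms(1)[OF ideal_I_ideal[OF assms]]] .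
  have lm_keys: "Poly_Mapping.keys (lead_monomial f) \<subseteq> {1..n}" if "f \<in> I_ideal n" "f \<noteq> 0" for f :: "'a mpoly"
    using carr that(1) lead_monomial(1)[OF that(2)] unfolding subset_eq in_carrier_mpoly_ring_iff by blast
  then have G_carr: "?G \<subseteq> carrier (mpoly_ring n)"
    using mpoly_carrier_closed(4) by blast
  show id: "ideal (J_ideal n) (mpoly_ring n :: 'a mpoly ring)"
    unfolding J_ideal_def initial_ideal_def by (rule ideal_genideal_mpoly[OF G_carr])
  have G: "?G \<subseteq> J_ideal n"
    unfolding J_ideal_def initial_ideal_def by (rule ring.genideal_self[OF mpoly_ring_ring G_carr])
  show "J_ideal n = ?N"
  proof
    have "ideal ?N (mpoly_ring n)"
    proof (rule mpoly_idealI)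
      show "p + q \<in> ?N" if "p \<in> ?N" "q \<in> ?N" for p q
        using that Poly_Mapping.keys_add[of p q] by (auto intro: mpoly_carrier_closed)
      show "p * q \<in> ?N" if p: "p \<in> carrier (mpoly_ring n)" and q: "q \<in> ?N" for p q
      proof (intro CollectI conjI ballI)
        show "p * q \<in> carrier (mpoly_ring n)"
          using p q by (auto intro: mpoly_carrier_closed)
        fix a assume "a \<in> Poly_Mapping.keys (p * q)"
        then obtain b c where "a = b + c" "c \<in> Poly_Mapping.keys q"
          using keys_mult[of p q] by blast
        then show "\<not> standard n a"
          using q standard_add[of n b c] by auto
      qed
    qed (auto simp: in_carrier_mpoly_ring_iff[of 0])
    moreover have "?G \<subseteq> ?N"
      using lead_monomial_not_standard[OF assms] G_carr by auto
    ultimately show "J_ideal n \<subseteq> ?N"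
      unfolding J_ideal_def initial_ideal_def by (intro ring.genideal_minimal[OF mpoly_ring_ring])
  next
    show "?N \<subseteq> J_ideal n"
    proof
      fix p assume p: "p \<in> ?N"
      have "Poly_Mapping.single a (Poly_Mapping.lookup p a) \<in> J_ideal n" if a: "a \<in> Poly_Mapping.keys p" for a
      proof -
        have "Poly_Mapping.keys a \<subseteq> {1..n}" "\<not> standard n a"
          using p a by (auto simp: in_carrier_mpoly_ring_iff)
        then obtain f where "f \<in> (I_ideal n :: 'a mpoly set)" "f \<noteq> 0" "lead_monomial f = a"
          using nonstandard_is_lead_monomial[OF assms] by blast
        then have "Poly_Mapping.single a 1 \<in> (J_ideal n :: 'a mpoly set)"
          using G by blast
        then have "Poly_Mapping.single 0 (Poly_Mapping.lookup p a) * Poly_Mapping.single a 1 \<in> J_ideal n"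
          by (intro mpoly_idealD(5)[OF id] mpoly_carrier_closed) auto
        then show ?thesis
          by (simp add: mult_single)
      qed
      then have "(\<Sum>a\<in>Poly_Mapping.keys p. Poly_Mapping.single a (Poly_Mapping.lookup p a)) \<in> J_ideal n"
        by (rule mpoly_ideal_sumI[OF id])
      then show "p \<in> J_ideal n"
        by (simp flip: poly_mapping_eq_sum_single)
    qed
  qed
qed

section \<open>Uniqueness of matrix forms\<close>

lemma mult_mat_vec_unit:
  fixes A :: "'a::semiring_1 mat"
  assumes "A \<in> carrier_mat r c" "i < r" "j < c"
  shows "(A *\<^sub>v unit_vec c j) $ i = A $$ (i, j)"
  using assms by simp

lemma mat_eq_if_mult_vec_eq:
  fixes A B :: "'a::semiring_1 mat"
  assumes "A \<in> carrier_mat r c" "B \<in> carrier_mat r c"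
    and "\<And>v. v \<in> carrier_vec c \<Longrightarrow> A *\<^sub>v v = B *\<^sub>v v"
  shows "A = B"
proof (rule eq_matI)
  fix i j assume "i < dim_row B" "j < dim_col B"
  then have "i < r" "j < c"
    using assms(2) by auto
  then show "A $$ (i, j) = B $$ (i, j)"
    using mult_mat_vec_unit[OF assms(1)] mult_mat_vec_unit[OF assms(2)]
      assms(3)[OF unit_vec_carrier, of j] by metis
qed (use assms in auto)

text \<open>The columns of the matrix are the images of the unit vectors. Linearity is used along the
  truncations of a vector to its first \<open>k\<close> entries.\<close>

lemma linear_vec_map_is_matrix:
  fixes h :: "'a::field vec \<Rightarrow> 'a vec"
  assumes carrier: "\<And>v. v \<in> carrier_vec d \<Longrightarrow> h v \<in> carrier_vec e"
    and add: "\<And>u v. u \<in> carrier_vec d \<Longrightarrow> v \<in> carrier_vec d \<Longrightarrow> h (u + v) = h u + h v"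
    and smult: "\<And>c v. v \<in> carrier_vec d \<Longrightarrow> h (c \<cdot>\<^sub>v v) = c \<cdot>\<^sub>v h v"
  obtains A where "A \<in> carrier_mat e d" "\<And>v. v \<in> carrier_vec d \<Longrightarrow> A *\<^sub>v v = h v"
proof -
  define A where "A = mat e d (\<lambda>(i, j). h (unit_vec d j) $ i)"
  have A: "A \<in> carrier_mat e d"
    by (simp add: A_def)
  have "A *\<^sub>v v = h v" if v: "v \<in> carrier_vec d" for v
  proof -
    define w where "w k = vec d (\<lambda>i. if i < k then v $ i else 0)" for k
    have w_carr: "w k \<in> carrier_vec d" for k
      by (simp add: w_def)
    have h_w: "h (w k) $ i = (\<Sum>j<k. A $$ (i, j) * v $ j)" if "k \<le> d" "i < e" for k i
      using that(1)
    proof (induction k)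
      case 0
      \<comment> \<open>compatibility with the scalar \<open>0\<close> gives \<open>h 0 = 0\<close>\<close>
      have "w 0 = 0 \<cdot>\<^sub>v w 0"
        by (auto simp: w_def)
      then have "h (w 0) = 0 \<cdot>\<^sub>v h (w 0)"
        using smult[OF w_carr[of 0], of 0] by simp
      then have "h (w 0) $ i = 0 * h (w 0) $ i"
        using carrier[OF w_carr[of 0]] that(2) by (metis carrier_vecD index_smult_vec(1))
      then show ?case
        by simp
    next
      case (Suc k)
      have "w (Suc k) = w k + v $ k \<cdot>\<^sub>v unit_vec d k"
        using Suc.prems by (intro eq_vecI) (auto simp: w_def less_Suc_eq)
      then have "h (w (Suc k)) = h (w k) + v $ k \<cdot>\<^sub>v h (unit_vec d k)"
        using w_carr by (simp add: add smult)
      then show ?case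
        using Suc that(2) carrier[OF unit_vec_carrier, of k] carrier[OF w_carr, of k]
        by (simp add: A_def mult.commute)
    qed
    have "w d = v"
      using v by (intro eq_vecI) (auto simp: w_def)
    with h_w[of d] have "h v $ i = (\<Sum>j<d. A $$ (i, j) * v $ j)" if "i < e" for i
      using that by simp
    then show ?thesis
      using A v carrier[OF v]
      by (intro eq_vecI) (auto simp: scalar_prod_def atLeast0LessThan)
  qed
  with A show ?thesis
    by (rule that)
qed

text \<open>The matrix of \<open>f'\<^sup>-\<^sup>1 \<circ> f\<close>.\<close>

lemma change_of_basis_matrix:
  fixes f f' :: "'a::field vec \<Rightarrow> 'v"
  assumes f: "f \<in> LinearCombinations.module_hom class_ring (module_vec TYPE('a) d) V"
    "bij_betw f (carrier_vec d) (carrier V)"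
    and f': "f' \<in> LinearCombinations.module_hom class_ring (module_vec TYPE('a) e) V"
    "bij_betw f' (carrier_vec e) (carrier V)"
  obtains A where "A \<in> carrier_mat e d" "\<And>v. v \<in> carrier_vec d \<Longrightarrow> f' (A *\<^sub>v v) = f v"
proof -
  define h where "h v = inv_into (carrier_vec e) f' (f v)" for v
  have h: "h v \<in> carrier_vec e" "f' (h v) = f v" if "v \<in> carrier_vec d" for v
    using that f(2) f'(2) bij_betw_apply[OF f(2) that]
    by (auto simp: h_def bij_betw_def inv_into_into f_inv_into_f)
  have inj: "u = v" if "f' u = f' v" "u \<in> carrier_vec e" "v \<in> carrier_vec e" for u v
    using that f'(2) by (auto simp: bij_betw_def inj_on_def)
  have add: "h (u + v) = h u + h v" if uv: "u \<in> carrier_vec d" "v \<in> carrier_vec d" for u v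
  proof (rule inj)
    show "f' (h (u + v)) = f' (h u + h v)"
      using LinearCombinations.module_hom_add[OF f(1), of u v] LinearCombinations.module_hom_add[OF f'(1), of "h u" "h v"] uv h
      by (simp add: module_vec_simps)
  qed (use uv h in auto)
  have smult: "h (c \<cdot>\<^sub>v v) = c \<cdot>\<^sub>v h v" if v: "v \<in> carrier_vec d" for c v
  proof (rule inj)
    show "f' (h (c \<cdot>\<^sub>v v)) = f' (c \<cdot>\<^sub>v h v)"
      using LinearCombinations.module_hom_smult[OF f(1), of c v] LinearCombinations.module_hom_smult[OF f'(1), of c "h v"] v h
      by (simp add: module_vec_simps)
  qed (use v h in auto)
  obtain A where "A \<in> carrier_mat e d" "\<And>v. v \<in> carrier_vec d \<Longrightarrow> A *\<^sub>v v = h v"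
    using linear_vec_map_is_matrix[OF h(1) add smult] by blast
  with h show ?thesis
    by (intro that[of A]) auto
qed

text \<open>In characteristic 0 the trace of an identity matrix determines its size, and \<open>P * Q\<close>
  and \<open>Q * P\<close> have the same trace.\<close>

lemma inverse_matrices_imp_square:
  fixes P Q :: "'a::field_char_0 mat"
  assumes "P \<in> carrier_mat d e" "Q \<in> carrier_mat e d" "P * Q = 1\<^sub>m d" "Q * P = 1\<^sub>m e"
  shows "d = e"
proof -
  have trace: "(\<Sum>i<m. (A * B) $$ (i, i)) = (\<Sum>i<m. \<Sum>j<k. A $$ (i, j) * B $$ (j, i))"
    if "A \<in> carrier_mat m k" "B \<in> carrier_mat k m" for A B :: "'a mat" and m k
    using that by (intro sum.cong) (auto simp: scalar_prod_def atLeast0LessThan)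
  have "of_nat d = (\<Sum>i<d. (P * Q) $$ (i, i))"
    by (simp add: assms(3))
  also have "\<dots> = (\<Sum>i<e. (Q * P) $$ (i, i))"
    unfolding trace[OF assms(1,2)] trace[OF assms(2,1)]
    by (subst sum.swap) (simp add: mult.commute)
  also have "\<dots> = of_nat e"
    by (simp add: assms(4))
  finally show ?thesis
    by simp
qed

text \<open>The two changes of basis between the coordinate maps are mutually inverse and intertwine the two
  actions. Since \<open>rep_class\<close> chooses a matrix form, this is what makes it computable from any given
  one.\<close>

lemma matrix_form_unique:
  fixes \<rho> \<rho>' :: "'g \<Rightarrow> 'a::field_char_0 mat"
  assumes "matrix_form G V \<phi> \<rho>" "matrix_form G V \<phi> \<rho>'"
  shows "rep_iso G \<rho> \<rho>'"
proof -
  obtain d f where d: "\<And>g. g \<in> carrier G \<Longrightarrow> \<rho> g \<in> carrier_mat d d"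
    and f: "f \<in> LinearCombinations.module_hom class_ring (module_vec TYPE('a) d) V"
      "bij_betw f (carrier_vec d) (carrier V)"
    and act: "\<And>g v. g \<in> carrier G \<Longrightarrow> v \<in> carrier_vec d \<Longrightarrow> f (\<rho> g *\<^sub>v v) = \<phi> g (f v)"
    using assms(1) unfolding matrix_form_def by blast
  obtain e f' where e: "\<And>g. g \<in> carrier G \<Longrightarrow> \<rho>' g \<in> carrier_mat e e"
    and f': "f' \<in> LinearCombinations.module_hom class_ring (module_vec TYPE('a) e) V"
      "bij_betw f' (carrier_vec e) (carrier V)"
    and act': "\<And>g v. g \<in> carrier G \<Longrightarrow> v \<in> carrier_vec e \<Longrightarrow> f' (\<rho>' g *\<^sub>v v) = \<phi> g (f' v)"
    using assms(2) unfolding matrix_form_def by blast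
  obtain Q where Q: "Q \<in> carrier_mat e d" "\<And>v. v \<in> carrier_vec d \<Longrightarrow> f' (Q *\<^sub>v v) = f v"
    using change_of_basis_matrix[OF f f'] by blast
  obtain P where P: "P \<in> carrier_mat d e" "\<And>v. v \<in> carrier_vec e \<Longrightarrow> f (P *\<^sub>v v) = f' v"
    using change_of_basis_matrix[OF f' f] by blast
  have inj: "u = v" if "f u = f v" "u \<in> carrier_vec d" "v \<in> carrier_vec d" for u v
    using that f(2) by (auto simp: bij_betw_def inj_on_def)
  have inj': "u = v" if "f' u = f' v" "u \<in> carrier_vec e" "v \<in> carrier_vec e" for u v
    using that f'(2) by (auto simp: bij_betw_def inj_on_def)
  have PQ: "P * Q = 1\<^sub>m d"
  proof (rule mat_eq_if_mult_vec_eq)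
    fix v :: "'a vec" assume v: "v \<in> carrier_vec d"
    then have "f (P *\<^sub>v (Q *\<^sub>v v)) = f v"
      using P Q by simp
    then show "(P * Q) *\<^sub>v v = 1\<^sub>m d *\<^sub>v v"
      using inj[of "P *\<^sub>v (Q *\<^sub>v v)" v] v P(1) Q(1) by (simp add: assoc_mult_mat_vec[OF P(1) Q(1)])
  qed (use P Q in auto)
  have QP: "Q * P = 1\<^sub>m e"
  proof (rule mat_eq_if_mult_vec_eq)
    fix v :: "'a vec" assume v: "v \<in> carrier_vec e"
    then have "f' (Q *\<^sub>v (P *\<^sub>v v)) = f' v"
      using P Q by simp
    then show "(Q * P) *\<^sub>v v = 1\<^sub>m e *\<^sub>v v"
      using inj'[of "Q *\<^sub>v (P *\<^sub>v v)" v] v P(1) Q(1) by (simp add: assoc_mult_mat_vec[OF Q(1) P(1)])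
  qed (use P Q in auto)
  have "d = e"
    using inverse_matrices_imp_square[OF P(1) Q(1) PQ QP] .
  have "similar_mat_wit (\<rho> g) (\<rho>' g) P Q" if g: "g \<in> carrier G" for g
  proof (rule similar_mat_witI)
    show "P * Q = 1\<^sub>m d" "Q * P = 1\<^sub>m d"
      using PQ QP \<open>d = e\<close> by auto
    show "\<rho> g = P * \<rho>' g * Q"
    proof (rule mat_eq_if_mult_vec_eq)
      fix v :: "'a vec" assume v: "v \<in> carrier_vec d"
      have Qv: "Q *\<^sub>v v \<in> carrier_vec e" "\<rho>' g *\<^sub>v (Q *\<^sub>v v) \<in> carrier_vec e"
        using Q(1) v e[OF g] by auto
      have "f (\<rho> g *\<^sub>v v) = f (P *\<^sub>v (\<rho>' g *\<^sub>v (Q *\<^sub>v v)))"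
        using act[OF g v] act'[OF g Qv(1)] Q(2)[OF v] P(2)[OF Qv(2)] by simp
      moreover have "\<rho> g *\<^sub>v v \<in> carrier_vec d"
        using d[OF g] v by simp
      moreover have "P *\<^sub>v (\<rho>' g *\<^sub>v (Q *\<^sub>v v)) \<in> carrier_vec d"
        using P(1) Qv(2) by simp
      ultimately have "\<rho> g *\<^sub>v v = P *\<^sub>v (\<rho>' g *\<^sub>v (Q *\<^sub>v v))"
        by (rule inj)
      also have "\<dots> = (P * \<rho>' g * Q) *\<^sub>v v"
        using assoc_mult_mat_vec[OF P(1) e[OF g] Qv(1)]
          assoc_mult_mat_vec[OF mult_carrier_mat[OF P(1) e[OF g]] Q(1) v] by simp
      finally show "\<rho> g *\<^sub>v v = (P * \<rho>' g * Q) *\<^sub>v v" .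
    qed (use d[OF g] P(1) Q(1) in auto)
  qed (use d[OF g] e[OF g] P(1) Q(1) \<open>d = e\<close> in auto)
  then show ?thesis
    unfolding rep_iso_def by blast
qed

lemma matrix_form_transfer:
  fixes \<rho> :: "'g \<Rightarrow> 'a::field mat"
  assumes "matrix_form G V \<phi> \<rho>"
    and h: "h \<in> LinearCombinations.module_hom class_ring V W" "bij_betw h (carrier V) (carrier W)"
    and equi: "\<And>g v. g \<in> carrier G \<Longrightarrow> v \<in> carrier V \<Longrightarrow> h (\<phi> g v) = \<psi> g (h v)"
  shows "matrix_form G W \<psi> \<rho>"
proof -
  obtain d f where \<rho>: "\<rho> \<in> mat_reps G" and d: "\<forall>g \<in> carrier G. \<rho> g \<in> carrier_mat d d"
    and f: "f \<in> LinearCombinations.module_hom class_ring (module_vec TYPE('a) d) V"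
      "bij_betw f (carrier_vec d) (carrier V)"
    and act: "\<And>g v. g \<in> carrier G \<Longrightarrow> v \<in> carrier_vec d \<Longrightarrow> f (\<rho> g *\<^sub>v v) = \<phi> g (f v)"
    using assms(1) unfolding matrix_form_def by blast
  have fV: "f v \<in> carrier V" if "v \<in> carrier_vec d" for v
    using that bij_betw_apply[OF f(2)] by blast
  have "h \<circ> f \<in> LinearCombinations.module_hom class_ring (module_vec TYPE('a) d) W"
    using f(1) h(1) fV by (auto simp: LinearCombinations.module_hom_def module_vec_simps Pi_iff)
  moreover have "bij_betw (h \<circ> f) (carrier_vec d) (carrier W)"
    using f(2) h(2) by (rule bij_betw_trans)
  moreover have "\<forall>g\<in>carrier G. \<forall>v\<in>carrier_vec d. (h \<circ> f) (\<rho> g *\<^sub>v v) = \<psi> g ((h \<circ> f) v)"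
    using act equi fV by simp
  ultimately show ?thesis
    unfolding matrix_form_def using \<rho> d by blast
qed

section \<open>Classes of matrix representations\<close>

definition mat_rep_class :: "('g, 'b) monoid_scheme \<Rightarrow> ('g \<Rightarrow> 'a::field mat) \<Rightarrow> (('g \<Rightarrow> 'a mat) \<Rightarrow>\<^sub>0 int) set" where
  "mat_rep_class G \<rho> = rep_relations G +>\<^bsub>free_rep_ring G\<^esub> frag_of \<rho>"

lemma free_rep_ring_simps [simp]:
  "add (free_rep_ring G) = (+)" "zero (free_rep_ring G) = 0"
  "x \<in> carrier (free_rep_ring G) \<longleftrightarrow> Poly_Mapping.keys x \<subseteq> mat_reps G"
  by (simp_all add: free_rep_ring_def)

lemma rep_relations_a_inv:
  fixes x :: "('g \<Rightarrow> 'a::field mat) \<Rightarrow>\<^sub>0 int"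
  assumes "x \<in> rep_relations G"
  shows "- x \<in> rep_relations G"
proof -
  interpret ideal "rep_relations G :: (('g \<Rightarrow> 'a mat) \<Rightarrow>\<^sub>0 int) set" "free_rep_ring G"
    by (rule rep_relations_ideal)
  have "\<ominus>\<^bsub>free_rep_ring G\<^esub> x = - x"
  proof (rule minus_equality)
    have "x \<in> carrier (free_rep_ring G)"
      using a_subset assms by blast
    then show "x \<in> carrier (free_rep_ring G)" "- x \<in> carrier (free_rep_ring G)"
      by simp_all
  qed simp
  then show ?thesis
    using additive_subgroup.a_inv_closed[OF is_additive_subgroup assms] by simp
qed

lemma rep_relations_add:
  fixes x :: "('g \<Rightarrow> 'a::field mat) \<Rightarrow>\<^sub>0 int"
  assumes "x \<in> rep_relations G" "y \<in> rep_relations G"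
  shows "x + y \<in> rep_relations G"
proof -
  interpret ideal "rep_relations G :: (('g \<Rightarrow> 'a mat) \<Rightarrow>\<^sub>0 int) set" "free_rep_ring G"
    by (rule rep_relations_ideal)
  show ?thesis
    using additive_subgroup.a_closed[OF is_additive_subgroup assms] by simp
qed

lemma rep_relations_coset_eqI:
  fixes x y :: "('g \<Rightarrow> 'a::field mat) \<Rightarrow>\<^sub>0 int"
  assumes "x - y \<in> rep_relations G"
  shows "rep_relations G +>\<^bsub>free_rep_ring G\<^esub> x = rep_relations G +>\<^bsub>free_rep_ring G\<^esub> y"
proof -
  have *: "rep_relations G +>\<^bsub>free_rep_ring G\<^esub> x \<subseteq> rep_relations G +>\<^bsub>free_rep_ring G\<^esub> y"
    if "x - y \<in> rep_relations G" for x y :: "('g \<Rightarrow> 'a mat) \<Rightarrow>\<^sub>0 int"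
  proof
    fix z assume "z \<in> rep_relations G +>\<^bsub>free_rep_ring G\<^esub> x"
    then obtain r where r: "r \<in> rep_relations G" "z = r + x"
      by (auto simp: a_r_coset_def')
    then have "z = (r + (x - y)) + y" "r + (x - y) \<in> rep_relations G"
      using rep_relations_add[OF r(1) that] by auto
    then show "z \<in> rep_relations G +>\<^bsub>free_rep_ring G\<^esub> y"
      unfolding a_r_coset_def' by (auto intro!: bexI[of _ "r + (x - y)"])
  qed
  show ?thesis
    using *[OF assms] *[of y x] rep_relations_a_inv[OF assms] by auto
qed

lemma rep_relations_generators:
  fixes \<rho> \<sigma> :: "'g \<Rightarrow> 'a::field mat"
  shows "\<rho> \<in> mat_reps G \<Longrightarrow> \<sigma> \<in> mat_reps G \<Longrightarrow> rep_iso G \<rho> \<sigma> \<Longrightarrow> frag_of \<rho> - frag_of \<sigma> \<in> rep_relations G"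
    and "\<rho> \<in> mat_reps G \<Longrightarrow> \<sigma> \<in> mat_reps G \<Longrightarrow> frag_of (rep_sum \<rho> \<sigma>) - (frag_of \<rho> + frag_of \<sigma>) \<in> rep_relations G"
  unfolding rep_relations_def genideal_def by blast+

lemma mat_rep_class_eqI:
  "\<rho> \<in> mat_reps G \<Longrightarrow> \<sigma> \<in> mat_reps G \<Longrightarrow> rep_iso G \<rho> \<sigma> \<Longrightarrow> mat_rep_class G \<rho> = mat_rep_class G \<sigma>"
  unfolding mat_rep_class_def by (intro rep_relations_coset_eqI rep_relations_generators)

text \<open>Replaces the unspecified matrix form inside \<open>rep_class\<close> by a known one.\<close>

lemma rep_class_eq:
  fixes \<rho> :: "'g \<Rightarrow> 'a::field_char_0 mat"
  assumes "matrix_form G V \<phi> \<rho>"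
  shows "rep_class G V \<phi> = mat_rep_class G \<rho>"
proof -
  have in_reps: "\<sigma> \<in> mat_reps G" if "matrix_form G V \<phi> \<sigma>" for \<sigma>
    using that by (simp add: matrix_form_def)
  define \<sigma> where "\<sigma> = (SOME \<rho>. matrix_form G V \<phi> \<rho>)"
  have \<sigma>: "matrix_form G V \<phi> \<sigma>"
    unfolding \<sigma>_def by (rule someI[of "matrix_form G V \<phi>", OF assms])
  have "mat_rep_class G \<sigma> = mat_rep_class G \<rho>"
    by (rule mat_rep_class_eqI[OF in_reps[OF \<sigma>] in_reps[OF assms] matrix_form_unique[OF \<sigma> assms]])
  then show ?thesis
    by (simp add: rep_class_def mat_rep_class_def \<sigma>_def)
qed

lemma mat_rep_class_closed:
  "\<rho> \<in> mat_reps G \<Longrightarrow> mat_rep_class G \<rho> \<in> carrier (rep_ring G :: (('g \<Rightarrow> 'a::field mat) \<Rightarrow>\<^sub>0 int) set ring)"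
proof -
  assume "\<rho> \<in> mat_reps G"
  interpret ideal "rep_relations G :: (('g \<Rightarrow> 'a mat) \<Rightarrow>\<^sub>0 int) set" "free_rep_ring G"
    by (rule rep_relations_ideal)
  show ?thesis
    using a_rcosetsI[OF a_subset, of "frag_of \<rho>"] \<open>\<rho> \<in> mat_reps G\<close>
    by (simp add: mat_rep_class_def rep_ring_def FactRing_def)
qed

lemma mat_rep_class_rep_sum:
  fixes \<rho> \<sigma> :: "'g \<Rightarrow> 'a::field mat"
  assumes "\<rho> \<in> mat_reps G" "\<sigma> \<in> mat_reps G"
  shows "mat_rep_class G (rep_sum \<rho> \<sigma>) = mat_rep_class G \<rho> \<oplus>\<^bsub>rep_ring G\<^esub> mat_rep_class G \<sigma>"
proof -
  interpret ideal "rep_relations G :: (('g \<Rightarrow> 'a mat) \<Rightarrow>\<^sub>0 int) set" "free_rep_ring G"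
    by (rule rep_relations_ideal)
  have "mat_rep_class G \<rho> \<oplus>\<^bsub>rep_ring G\<^esub> mat_rep_class G \<sigma> =
      rep_relations G +>\<^bsub>free_rep_ring G\<^esub> (frag_of \<rho> + frag_of \<sigma>)"
    using a_rcos_sum[of "frag_of \<rho>" "frag_of \<sigma>"] assms
    by (simp add: mat_rep_class_def rep_ring_def FactRing_def)
  also have "\<dots> = mat_rep_class G (rep_sum \<rho> \<sigma>)"
    unfolding mat_rep_class_def
    by (rule rep_relations_coset_eqI[symmetric]) (rule rep_relations_generators[OF assms])
  finally show ?thesis ..
qed

text \<open>Matrix representations are functions on a whole type of which only the values on \<open>carrier
  G\<close> matter: here for membership, and in \<open>rep_iso_cong\<close> for the isomorphism class.\<close>

lemma mat_reps_cong:
  fixes \<rho> \<sigma> :: "'g \<Rightarrow> 'a::field mat"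
  assumes "Group.monoid G" "\<And>g. g \<in> carrier G \<Longrightarrow> \<rho> g = \<sigma> g" "\<rho> \<in> mat_reps G"
  shows "\<sigma> \<in> mat_reps G"
  using assms(3) monoid.one_closed[OF assms(1)] monoid.m_closed[OF assms(1)]
  unfolding mat_reps_def by (simp add: assms(2)[symmetric])

lemma rep_iso_cong:
  assumes "\<rho> \<in> mat_reps G" "\<And>g. g \<in> carrier G \<Longrightarrow> \<rho> g = \<sigma> g"
  shows "rep_iso G \<rho> \<sigma>"
proof -
  obtain d where "\<forall>g \<in> carrier G. \<rho> g \<in> carrier_mat d d"
    using assms(1) by (auto simp: mat_reps_def)
  then have "\<forall>g\<in>carrier G. similar_mat_wit (\<rho> g) (\<sigma> g) (1\<^sub>m d) (1\<^sub>m d)"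
    using assms(2) similar_mat_wit_refl by metis
  then show ?thesis
    unfolding rep_iso_def by blast
qed

section \<open>Permutation representations\<close>

text \<open>An action on \<open>X\<close> by total functions, so that one \<open>\<alpha>\<close> (in the end,
  taking images of sets) can serve all invariant sets \<open>X\<close>.\<close>

definition acts_on :: "('g, 'b) monoid_scheme \<Rightarrow> ('g \<Rightarrow> 'x \<Rightarrow> 'x) \<Rightarrow> 'x set \<Rightarrow> bool" where
  "acts_on G \<alpha> X \<longleftrightarrow> (\<forall>g\<in>carrier G. \<forall>x\<in>X. \<alpha> g x \<in> X) \<and> (\<forall>x\<in>X. \<alpha> \<one>\<^bsub>G\<^esub> x = x) \<and>
     (\<forall>g\<in>carrier G. \<forall>h\<in>carrier G. \<forall>x\<in>X. \<alpha> (g \<otimes>\<^bsub>G\<^esub> h) x = \<alpha> g (\<alpha> h x))"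

lemma acts_on_UN:
  assumes "\<And>i. i \<in> I \<Longrightarrow> acts_on G \<alpha> (X i)"
  shows "acts_on G \<alpha> (\<Union>i\<in>I. X i)"
  unfolding acts_on_def
proof (intro conjI ballI)
  fix x assume "x \<in> (\<Union>i\<in>I. X i)"
  then obtain i where i: "i \<in> I" "x \<in> X i"
    by blast
  note acts = assms[OF i(1), unfolded acts_on_def]
  show "\<alpha> \<one>\<^bsub>G\<^esub> x = x"
    using acts i by simp
  fix g assume g: "g \<in> carrier G"
  show "\<alpha> g x \<in> (\<Union>i\<in>I. X i)"
    using acts i g by blast
  show "\<alpha> (g \<otimes>\<^bsub>G\<^esub> h) x = \<alpha> g (\<alpha> h x)" if "h \<in> carrier G" for h
    using acts i g that by simp
qed

definition perm_rep :: "('g \<Rightarrow> 'x \<Rightarrow> 'x) \<Rightarrow> 'x list \<Rightarrow> 'g \<Rightarrow> 'a::field mat" where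
  "perm_rep \<alpha> xs g = mat (length xs) (length xs) (\<lambda>(i, j). if xs ! i = \<alpha> g (xs ! j) then 1 else 0)"

lemma perm_rep_carrier [simp]: "perm_rep \<alpha> xs g \<in> carrier_mat (length xs) (length xs)"
  by (simp add: perm_rep_def)

lemma sum_nth_distinct:
  "distinct xs \<Longrightarrow> (\<Sum>i<length xs. F (xs ! i)) = (\<Sum>x\<in>set xs. F x)"
  by (rule sum.reindex_bij_betw) (rule bij_betw_nth; simp)

lemma perm_rep_in_mat_reps:
  assumes "distinct xs" "acts_on G \<alpha> (set xs)"
  shows "perm_rep \<alpha> xs \<in> (mat_reps G :: ('g \<Rightarrow> 'a::field mat) set)"
proof -
  have one: "perm_rep \<alpha> xs \<one>\<^bsub>G\<^esub> = (1\<^sub>m (length xs) :: 'a mat)"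
    using assms by (intro eq_matI) (auto simp: perm_rep_def acts_on_def nth_eq_iff_index_eq)
  have mult: "perm_rep \<alpha> xs (g \<otimes>\<^bsub>G\<^esub> h) = perm_rep \<alpha> xs g * (perm_rep \<alpha> xs h :: 'a mat)"
    if gh: "g \<in> carrier G" "h \<in> carrier G" for g h
  proof (rule eq_matI)
    fix i k
    assume "i < dim_row (perm_rep \<alpha> xs g * (perm_rep \<alpha> xs h :: 'a mat))"
      and "k < dim_col (perm_rep \<alpha> xs g * (perm_rep \<alpha> xs h :: 'a mat))"
    then have ik: "i < length xs" "k < length xs"
      by (simp_all add: perm_rep_def)
    have mem: "\<alpha> h (xs ! k) \<in> set xs" and comp: "\<alpha> (g \<otimes>\<^bsub>G\<^esub> h) (xs ! k) = \<alpha> g (\<alpha> h (xs ! k))"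
      using assms(2) gh ik by (auto simp: acts_on_def)
    have "(perm_rep \<alpha> xs g * (perm_rep \<alpha> xs h :: 'a mat)) $$ (i, k) =
        (\<Sum>j<length xs. (if xs ! i = \<alpha> g (xs ! j) then 1 else 0) * (if xs ! j = \<alpha> h (xs ! k) then 1 else 0))"
      using ik by (simp add: perm_rep_def scalar_prod_def atLeast0LessThan)
    also have "\<dots> = (\<Sum>x\<in>set xs. (if xs ! i = \<alpha> g x then 1 else 0) * (if x = \<alpha> h (xs ! k) then 1 else 0))"
      by (rule sum_nth_distinct[OF assms(1)])
    also have "\<dots> = (\<Sum>x\<in>set xs. if x = \<alpha> h (xs ! k) then (if xs ! i = \<alpha> g x then 1 else 0) else 0)"
      by (intro sum.cong) auto
    also have "\<dots> = (if xs ! i = \<alpha> g (\<alpha> h (xs ! k)) then 1 else 0)"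
      using mem by (subst sum.delta) auto
    also have "\<dots> = perm_rep \<alpha> xs (g \<otimes>\<^bsub>G\<^esub> h) $$ (i, k)"
      using ik by (simp add: perm_rep_def comp)
    finally show "perm_rep \<alpha> xs (g \<otimes>\<^bsub>G\<^esub> h) $$ (i, k) =
        (perm_rep \<alpha> xs g * (perm_rep \<alpha> xs h :: 'a mat)) $$ (i, k)" ..
  qed (simp_all add: perm_rep_def)
  show ?thesis
    unfolding mat_reps_def using one mult by (intro CollectI exI[of _ "length xs"]) auto
qed

text \<open>The off-diagonal blocks vanish because both parts of the list are invariant.\<close>

lemma perm_rep_append:
  assumes "distinct (xs @ ys)" "acts_on G \<alpha> (set xs)" "acts_on G \<alpha> (set ys)" "g \<in> carrier G"
  shows "rep_sum (perm_rep \<alpha> xs) (perm_rep \<alpha> ys) g = (perm_rep \<alpha> (xs @ ys) g :: 'a::field mat)"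
proof (rule eq_matI)
  fix i j
  assume "i < dim_row (perm_rep \<alpha> (xs @ ys) g :: 'a mat)" "j < dim_col (perm_rep \<alpha> (xs @ ys) g :: 'a mat)"
  then have ij: "i < length xs + length ys" "j < length xs + length ys"
    by (simp_all add: perm_rep_def)
  have nth_ys: "ys ! (k - length xs) \<in> set ys" if "\<not> k < length xs" "k < length xs + length ys" for k
    using that by (intro nth_mem) auto
  have disj: "x \<noteq> y" if "x \<in> set xs" "y \<in> set ys" for x y
    using assms(1) that by auto
  have cl: "x \<in> set xs \<Longrightarrow> \<alpha> g x \<in> set xs" "y \<in> set ys \<Longrightarrow> \<alpha> g y \<in> set ys" for x y
    using assms(2-4) by (auto simp: acts_on_def)
  have off1: "xs ! i \<noteq> \<alpha> g (ys ! (j - length xs))" if "i < length xs" "\<not> j < length xs"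
    using disj cl(2)[OF nth_ys] that ij by simp
  have off2: "ys ! (i - length xs) \<noteq> \<alpha> g (xs ! j)" if "\<not> i < length xs" "j < length xs"
    using disj[OF cl(1) nth_ys] that ij by (metis nth_mem)
  show "rep_sum (perm_rep \<alpha> xs) (perm_rep \<alpha> ys) g $$ (i, j) = (perm_rep \<alpha> (xs @ ys) g :: 'a mat) $$ (i, j)"
    using ij off1 off2 by (simp add: rep_sum_def perm_rep_def nth_append)
qed (simp_all add: rep_sum_def perm_rep_def)

lemma mat_rep_class_perm_rep_append:
  assumes "Group.monoid G" "distinct (xs @ ys)" "acts_on G \<alpha> (set xs)" "acts_on G \<alpha> (set ys)"
  shows "mat_rep_class G (perm_rep \<alpha> (xs @ ys) :: 'g \<Rightarrow> 'a::field mat) =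
    mat_rep_class G (perm_rep \<alpha> xs) \<oplus>\<^bsub>rep_ring G\<^esub> mat_rep_class G (perm_rep \<alpha> ys)"
proof -
  have acts: "acts_on G \<alpha> (set (xs @ ys))"
    using assms(3,4) by (auto simp: acts_on_def)
  have r: "perm_rep \<alpha> xs \<in> (mat_reps G :: ('g \<Rightarrow> 'a mat) set)"
    "perm_rep \<alpha> ys \<in> (mat_reps G :: ('g \<Rightarrow> 'a mat) set)"
    "perm_rep \<alpha> (xs @ ys) \<in> (mat_reps G :: ('g \<Rightarrow> 'a mat) set)"
    using assms acts by (auto intro!: perm_rep_in_mat_reps simp del: set_append)
  note eq = perm_rep_append[OF assms(2-4), symmetric, where 'a = 'a]
  have "mat_rep_class G (perm_rep \<alpha> (xs @ ys) :: 'g \<Rightarrow> 'a mat) =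
      mat_rep_class G (rep_sum (perm_rep \<alpha> xs) (perm_rep \<alpha> ys))"
    by (rule mat_rep_class_eqI[OF r(3) mat_reps_cong[OF assms(1) eq r(3)] rep_iso_cong[OF r(3) eq]])
  then show ?thesis
    by (simp add: mat_rep_class_rep_sum r)
qed

text \<open>Appending the empty list to itself shows that the class of the zero representation is idempotent for
  addition.\<close>

lemma mat_rep_class_perm_rep_Nil:
  assumes "Group.monoid G"
  shows "mat_rep_class G (perm_rep \<alpha> [] :: 'g \<Rightarrow> 'a::field mat) = \<zero>\<^bsub>rep_ring G\<^esub>"
proof -
  interpret ring "rep_ring G :: (('g \<Rightarrow> 'a mat) \<Rightarrow>\<^sub>0 int) set ring"
    by (rule rep_ring_ring)
  let ?c = "mat_rep_class G (perm_rep \<alpha> [] :: 'g \<Rightarrow> 'a mat)"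
  have acts: "acts_on G \<alpha> (set [])"
    by (simp add: acts_on_def)
  have "?c = ?c \<oplus>\<^bsub>rep_ring G\<^esub> ?c"
    using mat_rep_class_perm_rep_append[OF assms _ acts acts, where 'a = 'a] by simp
  moreover have "?c \<in> carrier (rep_ring G)"
    by (intro mat_rep_class_closed perm_rep_in_mat_reps acts) simp
  ultimately show ?thesis
    by (metis add.r_cancel_one')
qed

lemma mat_rep_class_perm_rep_concat:
  fixes L :: "nat \<Rightarrow> 'x list"
  assumes "Group.monoid G" "distinct (concat (map L [0..<m]))" "\<And>l. l < m \<Longrightarrow> acts_on G \<alpha> (set (L l))"
  shows "mat_rep_class G (perm_rep \<alpha> (concat (map L [0..<m])) :: 'g \<Rightarrow> 'a::field mat) =
    (\<Oplus>\<^bsub>rep_ring G\<^esub>l\<in>{..<m}. mat_rep_class G (perm_rep \<alpha> (L l)))"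
  using assms(2,3)
proof (induction m)
  interpret ring "rep_ring G :: (('g \<Rightarrow> 'a mat) \<Rightarrow>\<^sub>0 int) set ring"
    by (rule rep_ring_ring)
  {
    case 0
    show ?case
      by (simp add: mat_rep_class_perm_rep_Nil[OF assms(1)])
  next
    case (Suc m)
    have closed: "mat_rep_class G (perm_rep \<alpha> (L l) :: 'g \<Rightarrow> 'a mat) \<in> carrier (rep_ring G)" if "l < Suc m" for l
    proof (intro mat_rep_class_closed perm_rep_in_mat_reps Suc.prems(2) that)
      show "distinct (L l)"
        using Suc.prems(1) that by (auto simp: distinct_concat_iff less_Suc_eq)
    qed
    have acts: "acts_on G \<alpha> (set (concat (map L [0..<m])))"
      using acts_on_UN[of "{0..<m}" G \<alpha> "\<lambda>l. set (L l)"] Suc.prems(2) by simp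
    have "mat_rep_class G (perm_rep \<alpha> (concat (map L [0..<Suc m])) :: 'g \<Rightarrow> 'a mat) =
        mat_rep_class G (perm_rep \<alpha> (concat (map L [0..<m]))) \<oplus>\<^bsub>rep_ring G\<^esub> mat_rep_class G (perm_rep \<alpha> (L m))"
      using mat_rep_class_perm_rep_append[OF assms(1) _ acts Suc.prems(2)[of m], where 'a = 'a] Suc.prems(1)
      by simp
    also have "mat_rep_class G (perm_rep \<alpha> (concat (map L [0..<m])) :: 'g \<Rightarrow> 'a mat) =
        (\<Oplus>\<^bsub>rep_ring G\<^esub>l\<in>{..<m}. mat_rep_class G (perm_rep \<alpha> (L l)))"
      using Suc by simp
    finally show ?case
      using closed by (simp add: lessThan_Suc Pi_iff a_comm)
  }
qed

definition vec_to_free :: "'x list \<Rightarrow> 'a::field vec \<Rightarrow> 'x \<Rightarrow>\<^sub>0 'a" where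
  "vec_to_free xs v = (\<Sum>i<length xs. Poly_Mapping.single (xs ! i) (v $ i))"

lemma lookup_vec_to_free:
  "Poly_Mapping.lookup (vec_to_free xs v) x = (\<Sum>i<length xs. if xs ! i = x then v $ i else 0)"
  by (simp add: vec_to_free_def lookup_sum lookup_single when_def)

lemma lookup_lin_extend:
  assumes "finite S" "Poly_Mapping.keys f \<subseteq> S"
  shows "Poly_Mapping.lookup (lin_extend h f) y = (\<Sum>x\<in>S. if h x = y then Poly_Mapping.lookup f x else 0)"
proof -
  have "Poly_Mapping.lookup (lin_extend h f) y =
      (\<Sum>x\<in>Poly_Mapping.keys f. if h x = y then Poly_Mapping.lookup f x else 0)"
    by (simp add: lin_extend_def lookup_sum lookup_single when_def)
  also have "\<dots> = (\<Sum>x\<in>S. if h x = y then Poly_Mapping.lookup f x else 0)"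
    using assms by (intro sum.mono_neutral_left) (auto simp: in_keys_iff)
  finally show ?thesis .
qed

lemma lookup_map_times:
  fixes c :: "'a::field"
  shows "Poly_Mapping.lookup (Poly_Mapping.map ((*) c) p) x = c * Poly_Mapping.lookup p x"
  by (simp add: Poly_Mapping.map.rep_eq when_def)

lemma matrix_form_free_space:
  assumes "distinct xs" "acts_on G \<alpha> (set xs)"
  shows "matrix_form G (free_space (set xs)) (\<lambda>g. lin_extend (\<alpha> g)) (perm_rep \<alpha> xs :: 'g \<Rightarrow> 'a::field mat)"
proof -
  let ?d = "length xs" and ?f = "vec_to_free xs :: 'a vec \<Rightarrow> _"
  have lookup_nth: "Poly_Mapping.lookup (?f v) (xs ! i) = v $ i" if "i < ?d" for v i
  proof -
    have "(\<Sum>j<?d. if xs ! j = xs ! i then v $ j else 0) = (\<Sum>j<?d. if j = i then v $ j else 0)"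
      using that assms(1) by (intro sum.cong) (auto simp: nth_eq_iff_index_eq)
    then show ?thesis
      using that by (simp add: lookup_vec_to_free)
  qed
  have lookup_out: "Poly_Mapping.lookup (?f v) x = 0" if "x \<notin> set xs" for v x
    using that by (auto simp: lookup_vec_to_free intro!: sum.neutral)
  then have keys: "Poly_Mapping.keys (?f v) \<subseteq> set xs" for v
    by (auto simp: in_keys_iff)
  have eqI: "p = q" if "Poly_Mapping.keys p \<subseteq> set xs" "Poly_Mapping.keys q \<subseteq> set xs"
    "\<And>i. i < ?d \<Longrightarrow> Poly_Mapping.lookup p (xs ! i) = Poly_Mapping.lookup q (xs ! i)" for p q :: "_ \<Rightarrow>\<^sub>0 'a"
  proof (rule poly_mapping_eqI)
    fix x
    show "Poly_Mapping.lookup p x = Poly_Mapping.lookup q x"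
    proof (cases "x \<in> set xs")
      case True
      then show ?thesis
        using that(3) by (auto simp: in_set_conv_nth)
    next
      case False
      then have "x \<notin> Poly_Mapping.keys p" "x \<notin> Poly_Mapping.keys q"
        using that(1,2) by auto
      then show ?thesis
        by (simp add: in_keys_iff)
    qed
  qed
  have "?f \<in> LinearCombinations.module_hom class_ring (module_vec TYPE('a) ?d) (free_space (set xs))"
  proof -
    have "?f (u + v) = ?f u + ?f v" if "u \<in> carrier_vec ?d" "v \<in> carrier_vec ?d" for u v
      using that by (simp add: vec_to_free_def single_add sum.distrib)
    moreover have "?f (c \<cdot>\<^sub>v v) = Poly_Mapping.map ((*) c) (?f v)" if "v \<in> carrier_vec ?d" for c v
      using that
      by (intro poly_mapping_eqI)
         (auto simp: lookup_vec_to_free lookup_map_times sum_distrib_left intro!: sum.cong)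
    ultimately show ?thesis
      using keys by (auto simp: LinearCombinations.module_hom_def module_vec_simps free_space_def)
  qed
  moreover have "bij_betw ?f (carrier_vec ?d) (carrier (free_space (set xs)))"
  proof (rule bij_betwI[where g = "\<lambda>p. vec ?d (\<lambda>i. Poly_Mapping.lookup p (xs ! i))"])
    show "?f \<in> carrier_vec ?d \<rightarrow> carrier (free_space (set xs))"
      using keys by (auto simp: free_space_def)
    show "vec ?d (\<lambda>i. Poly_Mapping.lookup (?f v) (xs ! i)) = v" if "v \<in> carrier_vec ?d" for v
      using that by (intro eq_vecI) (auto simp: lookup_nth)
    show "?f (vec ?d (\<lambda>i. Poly_Mapping.lookup p (xs ! i))) = p" if "p \<in> carrier (free_space (set xs))" for p
      using that keys by (intro eqI) (auto simp: lookup_nth free_space_def)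
  qed auto
  moreover have "?f (perm_rep \<alpha> xs g *\<^sub>v v) = lin_extend (\<alpha> g) (?f v)"
    if g: "g \<in> carrier G" and v: "v \<in> carrier_vec ?d" for g v
  proof (rule poly_mapping_eqI)
    fix y
    have cl: "\<alpha> g (xs ! j) \<in> set xs" if "j < ?d" for j
      using assms(2) g that by (auto simp: acts_on_def)
    have entry: "(perm_rep \<alpha> xs g *\<^sub>v v) $ i = (\<Sum>j<?d. if xs ! i = \<alpha> g (xs ! j) then v $ j else 0)"
      if "i < ?d" for i
      using that v
      by (auto simp: perm_rep_def scalar_prod_def atLeast0LessThan intro!: sum.cong)
    have "Poly_Mapping.lookup (?f (perm_rep \<alpha> xs g *\<^sub>v v)) y =
        (\<Sum>i<?d. \<Sum>j<?d. if xs ! i = y \<and> xs ! i = \<alpha> g (xs ! j) then v $ j else 0)"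
      unfolding lookup_vec_to_free by (intro sum.cong) (auto simp: entry intro!: sum.cong)
    also have "\<dots> = (\<Sum>j<?d. \<Sum>i<?d. if xs ! i = y \<and> xs ! i = \<alpha> g (xs ! j) then v $ j else 0)"
      by (rule sum.swap)
    also have "\<dots> = (\<Sum>j<?d. \<Sum>x\<in>set xs. if x = \<alpha> g (xs ! j) then (if \<alpha> g (xs ! j) = y then v $ j else 0) else 0)"
      by (subst sum_nth_distinct[OF assms(1), where F = "\<lambda>x. if x = y \<and> x = _ then _ else 0"])
         (auto intro!: sum.cong sum.neutral)
    also have "\<dots> = (\<Sum>j<?d. if \<alpha> g (xs ! j) = y then v $ j else 0)"
      using cl by (intro sum.cong) (auto simp: sum.delta)
    also have "\<dots> = (\<Sum>j<?d. if \<alpha> g (xs ! j) = y then Poly_Mapping.lookup (?f v) (xs ! j) else 0)"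
      by (intro sum.cong) (auto simp: lookup_nth)
    also have "\<dots> = (\<Sum>x\<in>set xs. if \<alpha> g x = y then Poly_Mapping.lookup (?f v) x else 0)"
      by (rule sum_nth_distinct[OF assms(1)])
    also have "\<dots> = Poly_Mapping.lookup (lin_extend (\<alpha> g) (?f v)) y"
      by (rule lookup_lin_extend[symmetric]) (use keys in auto)
    finally show "Poly_Mapping.lookup (?f (perm_rep \<alpha> xs g *\<^sub>v v)) y = Poly_Mapping.lookup (lin_extend (\<alpha> g) (?f v)) y" .
  qed
  ultimately show ?thesis
    unfolding matrix_form_def using perm_rep_in_mat_reps[OF assms]
    by (intro conjI exI[of _ ?d] exI[of _ ?f]) auto
qed

section \<open>Linear extensions\<close>

lemma lin_extend_zero [simp]: "lin_extend h 0 = 0"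
  by (simp add: lin_extend_def)

lemma lin_extend_single [simp]: "lin_extend h (Poly_Mapping.single x c) = Poly_Mapping.single (h x) c"
  by (simp add: lin_extend_def)

lemma lin_extend_add: "lin_extend h (f + g) = lin_extend h f + lin_extend h g"
  unfolding lin_extend_def by (rule setsum_keys_plus_distrib) (auto simp: single_add)

lemma lin_extend_diff: "lin_extend h (f - g) = lin_extend h f - lin_extend h g"
  using lin_extend_add[of h "f - g" g] by simp

lemma lin_extend_lin_extend: "lin_extend h (lin_extend k f) = lin_extend (\<lambda>x. h (k x)) f"
  by (induction f rule: poly_mapping_induct_add) (auto simp: lin_extend_add)

lemma lin_extend_ident: "lin_extend (\<lambda>x. x) f = f"
  by (induction f rule: poly_mapping_induct_add) (auto simp: lin_extend_add)

lemma lin_extend_cong: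
  "(\<And>x. x \<in> Poly_Mapping.keys f \<Longrightarrow> h x = k x) \<Longrightarrow> lin_extend h f = lin_extend k f"
  by (simp add: lin_extend_def)

lemma keys_lin_extend: "Poly_Mapping.keys (lin_extend h f) \<subseteq> h ` Poly_Mapping.keys f"
proof
  fix y assume "y \<in> Poly_Mapping.keys (lin_extend h f)"
  then have "(\<Sum>x\<in>Poly_Mapping.keys f. if h x = y then Poly_Mapping.lookup f x else 0) \<noteq> 0"
    using lookup_lin_extend[of "Poly_Mapping.keys f" f h y] by (simp add: in_keys_iff)
  then obtain x where "x \<in> Poly_Mapping.keys f" "(if h x = y then Poly_Mapping.lookup f x else 0) \<noteq> 0"
    by (rule sum.not_neutral_contains_not_neutral)
  then show "y \<in> h ` Poly_Mapping.keys f"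
    by (auto split: if_splits)
qed

lemma lookup_lin_extend_inj:
  assumes "inj_on h S" "Poly_Mapping.keys f \<subseteq> S" "finite S" "x \<in> S"
  shows "Poly_Mapping.lookup (lin_extend h f) (h x) = Poly_Mapping.lookup f x"
proof -
  have "Poly_Mapping.lookup (lin_extend h f) (h x) = (\<Sum>y\<in>S. if h y = h x then Poly_Mapping.lookup f y else 0)"
    by (rule lookup_lin_extend[OF assms(3,2)])
  also have "\<dots> = (\<Sum>y\<in>S. if y = x then Poly_Mapping.lookup f y else 0)"
    using assms(1,4) by (intro sum.cong) (auto simp: inj_on_def)
  also have "\<dots> = Poly_Mapping.lookup f x"
    using assms(3,4) by simp
  finally show ?thesis .
qed

lemma lin_extend_map_times:
  "lin_extend h (Poly_Mapping.map ((*) c) f) = const c * lin_extend h (f :: 'x \<Rightarrow>\<^sub>0 'a::field)"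
proof (induction f rule: poly_mapping_induct_add)
  case (single x k)
  have "Poly_Mapping.map ((*) c) (Poly_Mapping.single x k) = Poly_Mapping.single x (c * k)"
    by (intro poly_mapping_eqI) (auto simp: lookup_map_times lookup_single when_def)
  then show ?case
    by (simp add: const_def mult_single)
next
  case (add f g)
  have "Poly_Mapping.map ((*) c) (f + g) = Poly_Mapping.map ((*) c) f + Poly_Mapping.map ((*) c) g"
    by (intro poly_mapping_eqI) (simp add: lookup_map_times lookup_add distrib_left)
  with add show ?case
    by (simp add: lin_extend_add distrib_left)
next
  case zero
  have "Poly_Mapping.map ((*) c) 0 = (0 :: 'x \<Rightarrow>\<^sub>0 'a)"
    by (intro poly_mapping_eqI) (simp add: lookup_map_times)
  then show ?case
    by simp
qed

section \<open>Standard monomials of a given degree\<close>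

text \<open>The sets \<open>A\<close> for which some \<open>x\<^sub>A x\<^sub>n\<^sup>m\<close> is standard of
  degree \<open>r\<close>; with \<open>m = r - |A|\<close> the inequality \<open>m + 2|A| \<le> 2n - 4\<close>
  becomes \<open>|A| + r \<le> 2n - 4\<close>.\<close>

definition standard_sets :: "nat \<Rightarrow> nat \<Rightarrow> nat set set" where
  "standard_sets n r = {A. A \<subseteq> {1..n - 1} \<and> card A \<le> r \<and> card A + r \<le> 2 * n - 4}"

definition standard_monomial :: "nat \<Rightarrow> nat \<Rightarrow> nat set \<Rightarrow> (nat \<Rightarrow>\<^sub>0 nat)" where
  "standard_monomial n r A = ones A + Poly_Mapping.single n (r - card A)"

lemma finite_standard_sets: "finite (standard_sets n r)"
  by (rule finite_subset[of _ "Pow {1..n - 1}"]) (auto simp: standard_sets_def)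

lemma lookup_standard_monomial:
  assumes "n \<ge> 1" "A \<subseteq> {1..n - 1}"
  shows "Poly_Mapping.lookup (standard_monomial n r A) i =
    (if i \<in> A then 1 else if i = n then r - card A else 0)"
  using assms finite_subset[OF assms(2)]
  by (auto simp: standard_monomial_def lookup_add lookup_ones lookup_single when_def)

lemma standard_monomial_properties:
  assumes "n \<ge> 2" "A \<in> standard_sets n r"
  shows "Poly_Mapping.keys (standard_monomial n r A) \<subseteq> {1..n}"
    and "mdeg (standard_monomial n r A) = r"
    and "standard n (standard_monomial n r A)"
proof -
  have A: "A \<subseteq> {1..n - 1}" "card A \<le> r" "card A + r \<le> 2 * n - 4" and fin: "finite A"
    using assms(2) by (auto simp: standard_sets_def intro: finite_subset)
  have n: "n \<ge> 1"
    using assms(1) by simp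
  note lookup = lookup_standard_monomial[OF n A(1)]
  show "Poly_Mapping.keys (standard_monomial n r A) \<subseteq> {1..n}"
    using A(1) n by (auto simp: in_keys_iff lookup split: if_splits)
  show "mdeg (standard_monomial n r A) = r"
    using A(2) by (simp add: standard_monomial_def mdeg_add)
  have "(\<Sum>i\<in>{1..<n}. Poly_Mapping.lookup (standard_monomial n r A) i) = (\<Sum>i\<in>{1..<n}. if i \<in> A then 1 else 0)"
    by (intro sum.cong) (auto simp: lookup)
  also have "\<dots> = card ({1..<n} \<inter> A)"
    by (simp add: sum.inter_restrict[symmetric])
  also have "{1..<n} \<inter> A = A"
    using A(1) n by (auto simp: subset_iff)
  finally show "standard n (standard_monomial n r A)"
    using A assms(1) by (auto simp: standard_def lookup)
qed

lemma standard_imp_standard_monomial: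
  assumes "n \<ge> 2" "Poly_Mapping.keys a \<subseteq> {1..n}" "standard n a" "mdeg a = r"
  shows "\<exists>A\<in>standard_sets n r. a = standard_monomial n r A"
proof -
  define A where "A = {i\<in>{1..<n}. Poly_Mapping.lookup a i = 1}"
  have le: "\<forall>i\<in>{1..<n}. Poly_Mapping.lookup a i \<le> 1"
    using assms(3) by (simp add: standard_def)
  note dec = squarefree_decomposition[OF assms(2) le A_def]
  have deg: "Poly_Mapping.lookup a n + card A = r"
    using mdeg_split[OF assms(2)] assms(1,4) dec(2) by simp
  have "A \<in> standard_sets n r"
    using assms(1,3) deg dec(2) by (auto simp: standard_sets_def standard_def A_def)
  moreover have "a = standard_monomial n r A"
    using dec(1) deg unfolding standard_monomial_def by (metis add_diff_cancel_right')
  ultimately show ?thesis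
    by blast
qed

lemma inj_on_standard_monomial:
  assumes "n \<ge> 2"
  shows "inj_on (standard_monomial n r) (standard_sets n r)"
proof (rule inj_onI)
  fix A B
  assume "A \<in> standard_sets n r" "B \<in> standard_sets n r"
    and eq: "standard_monomial n r A = standard_monomial n r B"
  then have AB: "A \<subseteq> {1..n - 1}" "B \<subseteq> {1..n - 1}"
    by (auto simp: standard_sets_def)
  have n: "n \<ge> 1"
    using assms by simp
  have "i \<in> A \<longleftrightarrow> i \<in> B" if "i \<in> {1..n - 1}" for i
  proof -
    have "i \<noteq> n"
      using that n by auto
    moreover have "Poly_Mapping.lookup (standard_monomial n r A) i = Poly_Mapping.lookup (standard_monomial n r B) i"
      by (simp only: eq)
    ultimately show ?thesis
      unfolding lookup_standard_monomial[OF n AB(1)] lookup_standard_monomial[OF n AB(2)]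
      by (simp split: if_splits)
  qed
  then show "A = B"
    using AB by blast
qed

section \<open>Permuting the variables\<close>

lemma lookup_map_key:
  "inj f \<Longrightarrow> Poly_Mapping.lookup (Poly_Mapping.map_key f p) x = Poly_Mapping.lookup p (f x)"
  by (simp add: map_key.rep_eq)

text \<open>The permutation fixes \<open>n\<close>, so it acts on standard monomials through the sets
  alone.\<close>

lemma permute_standard_monomial:
  assumes "n \<ge> 2" "\<sigma> permutes {1..n - 1}" "A \<subseteq> {1..n - 1}"
  shows "Poly_Mapping.map_key (inv_into UNIV \<sigma>) (standard_monomial n r A) = standard_monomial n r (\<sigma> ` A)"
proof (rule poly_mapping_eqI)
  fix j
  have inv: "inv_into UNIV \<sigma> permutes {1..n - 1}"
    using assms(2) by (rule permutes_inv)
  have sub: "\<sigma> ` A \<subseteq> {1..n - 1}"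
    using assms(2,3) permutes_image[OF assms(2)] by blast
  have card: "card (\<sigma> ` A) = card A"
    using permutes_inj_on[OF assms(2)] by (rule card_image)
  have mem: "inv_into UNIV \<sigma> j \<in> A \<longleftrightarrow> j \<in> \<sigma> ` A"
    using permutes_inverses[OF assms(2)] by (metis imageE image_eqI)
  have "\<sigma> n = n"
    using assms(1) by (intro permutes_not_in[OF assms(2)]) auto
  then have n: "inv_into UNIV \<sigma> j = n \<longleftrightarrow> j = n"
    using permutes_inverses[OF assms(2)] by metis
  show "Poly_Mapping.lookup (Poly_Mapping.map_key (inv_into UNIV \<sigma>) (standard_monomial n r A)) j =
      Poly_Mapping.lookup (standard_monomial n r (\<sigma> ` A)) j"
    using assms(1,3) sub by (simp add: lookup_map_key[OF permutes_inj[OF inv]] lookup_standard_monomial card mem n)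
qed

lemma standard_permute:
  assumes "n \<ge> 2" "\<sigma> permutes {1..n - 1}" "standard n (Poly_Mapping.map_key (inv_into UNIV \<sigma>) a)"
  shows "standard n a"
proof -
  have ivl: "{1..n - 1} = {1..<n}"
    using assms(1) by auto
  note \<sigma> = assms(2)[unfolded ivl]
  have inv: "inv_into UNIV \<sigma> permutes {1..<n}"
    using \<sigma> by (rule permutes_inv)
  have lookup: "Poly_Mapping.lookup (Poly_Mapping.map_key (inv_into UNIV \<sigma>) a) (\<sigma> i) = Poly_Mapping.lookup a i" for i
    by (simp add: lookup_map_key[OF permutes_inj[OF inv]] permutes_inverses[OF \<sigma>])
  let ?b = "Poly_Mapping.map_key (inv_into UNIV \<sigma>) a"
  have "(\<Sum>i\<in>{1..<n}. Poly_Mapping.lookup a i) = (\<Sum>i\<in>{1..<n}. Poly_Mapping.lookup ?b i)"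
    using sum.permute[OF \<sigma>, of "Poly_Mapping.lookup ?b"] by (simp add: o_def lookup)
  moreover have "Poly_Mapping.lookup ?b n = Poly_Mapping.lookup a n"
    using lookup[of n] permutes_not_in[OF \<sigma>, of n] by simp
  moreover have "Poly_Mapping.lookup a i \<le> 1" if "i \<in> {1..<n}" for i
  proof -
    have "\<sigma> i \<in> {1..<n}"
      using permutes_in_image[OF \<sigma>] that by simp
    then have "Poly_Mapping.lookup ?b (\<sigma> i) \<le> 1"
      using assms(3) unfolding standard_def by blast
    then show ?thesis
      by (simp add: lookup)
  qed
  ultimately show ?thesis
    using assms(3) by (simp add: standard_def)
qed

lemma permute_vars_J_ideal:
  fixes p :: "'a::field mpoly"
  assumes "n \<ge> 2" "\<sigma> permutes {1..n - 1}" "p \<in> J_ideal n"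
  shows "permute_vars \<sigma> p \<in> J_ideal n"
proof -
  have \<sigma>n: "\<sigma> permutes {1..n}"
    using assms(2) by (rule permutes_subset) auto
  have p: "\<And>a. a \<in> Poly_Mapping.keys p \<Longrightarrow> Poly_Mapping.keys a \<subseteq> {1..n}"
    "\<And>a. a \<in> Poly_Mapping.keys p \<Longrightarrow> \<not> standard n a"
    using assms(3) unfolding J_ideal_eq[OF assms(1)] by (auto simp: in_carrier_mpoly_ring_iff)
  have "Poly_Mapping.keys b \<subseteq> {1..n} \<and> \<not> standard n b" 
    if b: "b \<in> Poly_Mapping.keys (permute_vars \<sigma> p)" for b
  proof -
    obtain a where a: "a \<in> Poly_Mapping.keys p" "b = Poly_Mapping.map_key (inv_into UNIV \<sigma>) a"
      using b keys_lin_extend[of "Poly_Mapping.map_key (inv_into UNIV \<sigma>)" p]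
      unfolding permute_vars_def by blast
    have "Poly_Mapping.keys b = inv_into UNIV \<sigma> -` Poly_Mapping.keys a"
      unfolding a(2) by (rule keys_map_key[OF permutes_inj[OF permutes_inv[OF assms(2)]]])
    also have "\<dots> \<subseteq> inv_into UNIV \<sigma> -` {1..n}"
      using p(1)[OF a(1)] by blast
    also have "\<dots> = {1..n}"
      by (rule permutes_vimage[OF permutes_inv[OF \<sigma>n]])
    finally show ?thesis
      using standard_permute[OF assms(1,2), of a] p(2)[OF a(1)] a(2) by auto
  qed
  then show ?thesis
    unfolding J_ideal_eq[OF assms(1)] by (auto simp: in_carrier_mpoly_ring_iff)
qed

lemma permute_vars_inv:
  fixes p :: "'a::field mpoly"
  assumes "\<sigma> permutes S"
  shows "permute_vars \<sigma> (permute_vars (inv_into UNIV \<sigma>) p) = p"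
proof -
  have "Poly_Mapping.map_key (inv_into UNIV \<sigma>) (Poly_Mapping.map_key (inv_into UNIV (inv_into UNIV \<sigma>)) a) = a" for a :: "nat \<Rightarrow>\<^sub>0 nat"
    using permutes_inj[OF assms] permutes_inj[OF permutes_inv[OF assms]]
    by (intro poly_mapping_eqI)
       (simp add: permutes_inv_inv[OF assms] lookup_map_key permutes_inverses[OF assms])
  then show ?thesis
    by (simp add: permute_vars_def lin_extend_lin_extend lin_extend_ident)
qed

text \<open>Both \<open>\<sigma>\<close> and its inverse preserve the set of nonstandard monomials, so
  \<open>\<sigma>\<close> maps \<open>J\<^sub>n\<close> onto itself and cosets onto cosets.\<close>

lemma permute_cosets_J_ideal:
  fixes p :: "'a::field mpoly"
  assumes "n \<ge> 2" "\<sigma> permutes {1..n - 1}"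
  shows "permute_cosets \<sigma> (J_ideal n +>\<^bsub>mpoly_ring n\<^esub> p) = J_ideal n +>\<^bsub>mpoly_ring n\<^esub> permute_vars \<sigma> p"
proof -
  have add: "permute_vars \<sigma> (q + p) = permute_vars \<sigma> q + permute_vars \<sigma> p" for q :: "'a mpoly"
    by (simp add: permute_vars_def lin_extend_add)
  have "permute_vars \<sigma> ` J_ideal n = (J_ideal n :: 'a mpoly set)"
  proof
    show "permute_vars \<sigma> ` J_ideal n \<subseteq> (J_ideal n :: 'a mpoly set)"
      using permute_vars_J_ideal[OF assms] by blast
    show "J_ideal n \<subseteq> permute_vars \<sigma> ` (J_ideal n :: 'a mpoly set)"
      using permute_vars_J_ideal[OF assms(1) permutes_inv[OF assms(2)]] permute_vars_inv[OF assms(2)]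
      by (metis image_eqI subsetI)
  qed
  moreover have "J_ideal n +>\<^bsub>mpoly_ring n\<^esub> q = (\<lambda>h. h + q) ` J_ideal n" for q :: "'a mpoly"
    by (auto simp: a_r_coset_def')
  moreover have "permute_vars \<sigma> ` (\<lambda>h. h + p) ` J_ideal n =
      (\<lambda>h. h + permute_vars \<sigma> p) ` permute_vars \<sigma> ` J_ideal n"
    by (simp add: image_image add)
  ultimately show ?thesis
    by (simp only: permute_cosets_def)
qed

section \<open>The graded components of the quotient\<close>

lemma quot_component_simps:
  "carrier (quot_component n J r) = {J +>\<^bsub>mpoly_ring n\<^esub> p | p. p \<in> carrier (mpoly_ring n) \<and> homogeneous r p}"
  "add (quot_component n J r) = set_add (mpoly_ring n)"
  "smult (quot_component n J r) = (\<lambda>c X. rcoset_mult (mpoly_ring n) J (J +>\<^bsub>mpoly_ring n\<^esub> const c) X)"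
  by (simp_all add: quot_component_def Let_def FactRing_def)

lemma J_ideal_coset_eq_iff:
  fixes p q :: "'a::field mpoly"
  assumes "n \<ge> 2"
  shows "J_ideal n +>\<^bsub>mpoly_ring n\<^esub> p = J_ideal n +>\<^bsub>mpoly_ring n\<^esub> q \<longleftrightarrow> p - q \<in> J_ideal n"
proof -
  note J = mpoly_idealD[OF ideal_J_ideal[OF assms, where 'a = 'a]]
  have mem: "x \<in> J_ideal n +>\<^bsub>mpoly_ring n\<^esub> y \<longleftrightarrow> x - y \<in> J_ideal n" for x y :: "'a mpoly"
    by (auto simp: a_r_coset_def' intro!: bexI[of _ "x - y"])
  show ?thesis
  proof
    assume "J_ideal n +>\<^bsub>mpoly_ring n\<^esub> p = J_ideal n +>\<^bsub>mpoly_ring n\<^esub> q"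
    then have "p \<in> J_ideal n +>\<^bsub>mpoly_ring n\<^esub> q"
      using mem[of p p] J(1) by simp
    then show "p - q \<in> J_ideal n"
      by (simp add: mem)
  next
    assume pq: "p - q \<in> J_ideal n"
    have "x - p \<in> J_ideal n \<longleftrightarrow> x - q \<in> J_ideal n" for x
      using J(2)[OF _ pq, of "x - p"] J(4)[OF _ pq, of "x - q"] by auto
    then show "J_ideal n +>\<^bsub>mpoly_ring n\<^esub> p = J_ideal n +>\<^bsub>mpoly_ring n\<^esub> q"
      by (auto simp: mem)
  qed
qed

definition component_iso :: "nat \<Rightarrow> nat \<Rightarrow> (nat set \<Rightarrow>\<^sub>0 'a::field) \<Rightarrow> 'a mpoly set" where
  "component_iso n r f = J_ideal n +>\<^bsub>mpoly_ring n\<^esub> lin_extend (standard_monomial n r) f"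

lemma lin_extend_standard_monomial:
  fixes f :: "nat set \<Rightarrow>\<^sub>0 'a::field"
  assumes "n \<ge> 2" "Poly_Mapping.keys f \<subseteq> standard_sets n r"
  shows "lin_extend (standard_monomial n r) f \<in> carrier (mpoly_ring n)"
    and "homogeneous r (lin_extend (standard_monomial n r) f)"
    and "\<And>a. a \<in> Poly_Mapping.keys (lin_extend (standard_monomial n r) f) \<Longrightarrow> standard n a"
proof -
  have *: "Poly_Mapping.keys a \<subseteq> {1..n} \<and> mdeg a = r \<and> standard n a"
    if a: "a \<in> Poly_Mapping.keys (lin_extend (standard_monomial n r) f)" for a
  proof -
    obtain A where "A \<in> standard_sets n r" "a = standard_monomial n r A"
      using keys_lin_extend[of "standard_monomial n r" f] a assms(2) by blast
    then show ?thesis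
      using standard_monomial_properties[OF assms(1)] by blast
  qed
  then show "lin_extend (standard_monomial n r) f \<in> carrier (mpoly_ring n)"
    "homogeneous r (lin_extend (standard_monomial n r) f)"
    "\<And>a. a \<in> Poly_Mapping.keys (lin_extend (standard_monomial n r) f) \<Longrightarrow> standard n a"
    unfolding in_carrier_mpoly_ring_iff homogeneous_def by blast+
qed

lemma component_iso_hom:
  assumes "n \<ge> 2"
  shows "component_iso n r \<in> LinearCombinations.module_hom class_ring (free_space (standard_sets n r))
    (quot_component n (J_ideal n :: 'a::field mpoly set) r)"
proof -
  interpret ideal "J_ideal n :: 'a mpoly set" "mpoly_ring n"
    by (rule ideal_J_ideal[OF assms])
  note lin = lin_extend_standard_monomial[OF assms]
  have const: "const c \<in> carrier (mpoly_ring n :: 'a mpoly ring)" for c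
    unfolding const_def by (rule mpoly_carrier_closed(4)) simp
  have "component_iso n r f \<in> carrier (quot_component n (J_ideal n :: 'a mpoly set) r)"
    if "Poly_Mapping.keys f \<subseteq> standard_sets n r" for f
    unfolding quot_component_simps component_iso_def using lin(1,2)[OF that] by blast
  moreover have "component_iso n r (f + g) =
      component_iso n r f \<oplus>\<^bsub>quot_component n (J_ideal n :: 'a mpoly set) r\<^esub> component_iso n r g"
    if "Poly_Mapping.keys f \<subseteq> standard_sets n r" "Poly_Mapping.keys g \<subseteq> standard_sets n r" for f g
    using a_rcos_sum[OF lin(1)[OF that(1)] lin(1)[OF that(2)]]
    by (simp add: quot_component_simps component_iso_def lin_extend_add)
  moreover have "component_iso n r (Poly_Mapping.map ((*) c) f) =
      c \<odot>\<^bsub>quot_component n (J_ideal n :: 'a mpoly set) r\<^esub> component_iso n r f"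
    if "Poly_Mapping.keys f \<subseteq> standard_sets n r" for f c
    using rcoset_mult_add[OF const lin(1)[OF that], of c]
    by (simp add: quot_component_simps component_iso_def lin_extend_map_times)
  ultimately show ?thesis
    unfolding LinearCombinations.module_hom_def by (simp add: free_space_def Pi_iff)
qed

text \<open>Injectivity: a combination of standard monomials lies in \<open>J\<^sub>n\<close> only if it is
  zero. Surjectivity: dropping the nonstandard monomials of a homogeneous polynomial does not change its
  coset.\<close>

lemma component_iso_bij:
  assumes "n \<ge> 2"
  shows "bij_betw (component_iso n r) (carrier (free_space (standard_sets n r)))
    (carrier (quot_component n (J_ideal n :: 'a::field mpoly set) r))"
proof (rule bij_betw_imageI)
  note lin = lin_extend_standard_monomial[OF assms]
  let ?X = "standard_sets n r" and ?m = "standard_monomial n r"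
  show "inj_on (component_iso n r :: _ \<Rightarrow> 'a mpoly set) (carrier (free_space ?X))"
  proof (rule inj_onI)
    fix f g :: "nat set \<Rightarrow>\<^sub>0 'a"
    assume "f \<in> carrier (free_space ?X)" "g \<in> carrier (free_space ?X)"
      and eq: "(component_iso n r f :: 'a mpoly set) = component_iso n r g"
    then have fg: "Poly_Mapping.keys f \<subseteq> ?X" "Poly_Mapping.keys g \<subseteq> ?X"
      by (simp_all add: free_space_def)
    have keys: "Poly_Mapping.keys (f - g) \<subseteq> ?X"
    proof
      fix A assume "A \<in> Poly_Mapping.keys (f - g)"
      then have "A \<in> Poly_Mapping.keys f \<or> A \<in> Poly_Mapping.keys g"
        by (auto simp: in_keys_iff lookup_minus)
      then show "A \<in> ?X"
        using fg by blast
    qed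
    have "lin_extend ?m (f - g) \<in> J_ideal n"
      unfolding lin_extend_diff
      by (rule J_ideal_coset_eq_iff[OF assms, THEN iffD1]) (use eq in \<open>simp only: component_iso_def\<close>)
    then have "Poly_Mapping.keys (lin_extend ?m (f - g)) = {}"
      using lin(3)[OF keys] unfolding J_ideal_eq[OF assms] by blast
    then have "Poly_Mapping.lookup (f - g) A = 0" if "A \<in> ?X" for A
      using lookup_lin_extend_inj[OF inj_on_standard_monomial[OF assms] keys finite_standard_sets that]
      by (metis empty_iff in_keys_iff)
    then have "Poly_Mapping.lookup (f - g) A = 0" for A
      using keys by (cases "A \<in> ?X") (auto simp: in_keys_iff subset_iff)
    then show "f = g"
      by (intro poly_mapping_eqI) (simp add: lookup_minus)
  qed
  show "component_iso n r ` carrier (free_space ?X) = carrier (quot_component n (J_ideal n :: 'a mpoly set) r)"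
  proof
    show "component_iso n r ` carrier (free_space ?X) \<subseteq> carrier (quot_component n (J_ideal n :: 'a mpoly set) r)"
      using LinearCombinations.module_hom_closed[OF component_iso_hom[OF assms]] by blast
    show "carrier (quot_component n (J_ideal n :: 'a mpoly set) r) \<subseteq> component_iso n r ` carrier (free_space ?X)"
    proof
      fix Y assume "Y \<in> carrier (quot_component n (J_ideal n :: 'a mpoly set) r)"
      then obtain p where Y: "Y = J_ideal n +>\<^bsub>mpoly_ring n\<^esub> p"
        and p: "p \<in> carrier (mpoly_ring n)" "homogeneous r p"
        by (auto simp: quot_component_simps)
      define f where "f = (\<Sum>A\<in>?X. Poly_Mapping.single A (Poly_Mapping.lookup p (?m A)))"
      have lookup_f: "Poly_Mapping.lookup f A = (if A \<in> ?X then Poly_Mapping.lookup p (?m A) else 0)" for A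
        by (simp add: f_def lookup_sum lookup_single when_def finite_standard_sets)
      have keys: "Poly_Mapping.keys f \<subseteq> ?X"
        by (auto simp: in_keys_iff lookup_f split: if_splits)
      let ?q = "p - lin_extend ?m f"
      have "?q \<in> carrier (mpoly_ring n)"
        using p(1) lin(1)[OF keys] by (rule mpoly_carrier_closed)
      moreover have "\<not> standard n a" if a: "a \<in> Poly_Mapping.keys ?q" for a
      proof
        assume std: "standard n a"
        have "a \<in> Poly_Mapping.keys p \<or> a \<in> Poly_Mapping.keys (lin_extend ?m f)"
          using a by (auto simp: in_keys_iff lookup_minus)
        then have "Poly_Mapping.keys a \<subseteq> {1..n}" "mdeg a = r"
          using p lin(1,2)[OF keys] unfolding in_carrier_mpoly_ring_iff homogeneous_def by blast+
        then obtain A where A: "A \<in> ?X" "a = ?m A"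
          using standard_imp_standard_monomial[OF assms _ std] by blast
        have "Poly_Mapping.lookup (lin_extend ?m f) a = Poly_Mapping.lookup p a"
          using lookup_lin_extend_inj[OF inj_on_standard_monomial[OF assms] keys finite_standard_sets A(1)] A
          by (simp add: lookup_f)
        with a show False
          by (simp add: in_keys_iff lookup_minus)
      qed
      ultimately have "?q \<in> J_ideal n"
        unfolding J_ideal_eq[OF assms] by blast
      then have "Y = component_iso n r f"
        unfolding Y component_iso_def J_ideal_coset_eq_iff[OF assms] .
      moreover have "f \<in> carrier (free_space ?X)"
        using keys by (simp add: free_space_def)
      ultimately show "Y \<in> component_iso n r ` carrier (free_space ?X)"
        by blast
    qed
  qed
qed

lemma component_iso_equivariant:
  fixes f :: "nat set \<Rightarrow>\<^sub>0 'a::field"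
  assumes "n \<ge> 2" "\<sigma> permutes {1..n - 1}" "Poly_Mapping.keys f \<subseteq> standard_sets n r"
  shows "component_iso n r (lin_extend (image \<sigma>) f) = permute_cosets \<sigma> (component_iso n r f)"
proof -
  have "standard_monomial n r (\<sigma> ` A) = Poly_Mapping.map_key (inv_into UNIV \<sigma>) (standard_monomial n r A)"
    if "A \<in> Poly_Mapping.keys f" for A
    using permute_standard_monomial[OF assms(1,2)] assms(3) that by (force simp: standard_sets_def)
  then have "lin_extend (standard_monomial n r) (lin_extend (image \<sigma>) f) =
      permute_vars \<sigma> (lin_extend (standard_monomial n r) f)"
    by (simp add: permute_vars_def lin_extend_lin_extend cong: lin_extend_cong)
  then show ?thesis
    by (simp add: component_iso_def permute_cosets_J_ideal[OF assms(1,2)])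
qed

section \<open>The graded character\<close>

lemma sym_group_acts_on:
  assumes "\<And>\<sigma> A. \<sigma> permutes {1..m} \<Longrightarrow> A \<in> X \<Longrightarrow> \<sigma> ` A \<in> X"
  shows "acts_on (sym_group m) image X"
  using assms by (auto simp: acts_on_def sym_group_def image_comp)

lemma permutes_image_subset: "\<sigma> permutes S \<Longrightarrow> A \<subseteq> S \<Longrightarrow> \<sigma> ` A \<subseteq> S"
  using permutes_image[of \<sigma> S] by blast

lemma permutes_card_image: "\<sigma> permutes S \<Longrightarrow> card (\<sigma> ` A) = card A"
  using permutes_inj_on card_image by blast

lemma acts_on_standard_sets: "acts_on (sym_group (n - 1)) image (standard_sets n r)"
proof (rule sym_group_acts_on)
  fix \<sigma> A
  assume "\<sigma> permutes {1..n - 1}" "A \<in> standard_sets n r"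
  then show "\<sigma> ` A \<in> standard_sets n r"
    using permutes_image_subset[of \<sigma> "{1..n - 1}" A] permutes_card_image[of \<sigma> "{1..n - 1}" A]
    unfolding standard_sets_def by simp
qed

lemma acts_on_subsets_of_size: "acts_on (sym_group m) image (subsets_of_size l m)"
proof (rule sym_group_acts_on)
  fix \<sigma> A
  assume "\<sigma> permutes {1..m}" "A \<in> subsets_of_size l m"
  then show "\<sigma> ` A \<in> subsets_of_size l m"
    using permutes_image_subset[of \<sigma> "{1..m}" A] permutes_card_image[of \<sigma> "{1..m}" A]
    unfolding subsets_of_size_def by simp
qed

lemma rep_class_component:
  assumes "n \<ge> 2" "distinct xs" "set xs = standard_sets n r"
  shows "rep_class (sym_group (n - 1)) (quot_component n (J_ideal n :: 'a::field_char_0 mpoly set) r) permute_cosets =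
    mat_rep_class (sym_group (n - 1)) (perm_rep image xs)"
proof (rule rep_class_eq)
  have "acts_on (sym_group (n - 1)) image (set xs)"
    unfolding assms(3) by (rule acts_on_standard_sets)
  from matrix_form_free_space[OF assms(2) this, where 'a = 'a]
  have "matrix_form (sym_group (n - 1)) (free_space (standard_sets n r))
      (\<lambda>\<sigma>. lin_extend (image \<sigma>)) (perm_rep image xs :: _ \<Rightarrow> 'a mat)"
    by (simp add: assms(3))
  then show "matrix_form (sym_group (n - 1)) (quot_component n (J_ideal n :: 'a mpoly set) r) permute_cosets
      (perm_rep image xs)"
  proof (rule matrix_form_transfer[OF _ component_iso_hom[OF assms(1)] component_iso_bij[OF assms(1)]])
    fix \<sigma> and f :: "nat set \<Rightarrow>\<^sub>0 'a"
    assume "\<sigma> \<in> carrier (sym_group (n - 1))" "f \<in> carrier (free_space (standard_sets n r))"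
    then have "\<sigma> permutes {1..n - 1}" "Poly_Mapping.keys f \<subseteq> standard_sets n r"
      by (simp_all only: sym_group_carrier) (simp add: free_space_def)
    then show "component_iso n r (lin_extend (image \<sigma>) f) = permute_cosets \<sigma> (component_iso n r f)"
      by (rule component_iso_equivariant[OF assms(1)])
  qed
qed

lemma subset_rep_class_eq:
  assumes "distinct xs" "set xs = subsets_of_size l m"
  shows "subset_rep_class l m =
    (mat_rep_class (sym_group m) (perm_rep image xs) :: (((nat \<Rightarrow> nat) \<Rightarrow> 'a::field_char_0 mat) \<Rightarrow>\<^sub>0 int) set)"
  unfolding subset_rep_class_def
proof (rule rep_class_eq)
  have "acts_on (sym_group m) image (set xs)"
    by (simp add: assms(2) acts_on_subsets_of_size)
  from matrix_form_free_space[OF assms(1) this, where 'a = 'a]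
  show "matrix_form (sym_group m) (free_space (subsets_of_size l m))
      (\<lambda>\<sigma>. lin_extend (image \<sigma>)) (perm_rep image xs :: _ \<Rightarrow> 'a mat)"
    by (simp add: assms(2))
qed

lemma finite_subsets_of_size: "finite (subsets_of_size l m)"
  by (rule finite_subset[of _ "Pow {1..m}"]) (auto simp: subsets_of_size_def)

lemma subset_rep_class_closed:
  "subset_rep_class l m \<in> carrier (rep_ring (sym_group m) :: (((nat \<Rightarrow> nat) \<Rightarrow> 'a::field_char_0 mat) \<Rightarrow>\<^sub>0 int) set ring)"
proof -
  obtain xs where xs: "set xs = subsets_of_size l m" "distinct xs"
    using finite_distinct_list[OF finite_subsets_of_size] by blast
  show ?thesis
    unfolding subset_rep_class_eq[OF xs(2,1)]
    by (intro mat_rep_class_closed perm_rep_in_mat_reps xs(2)) (simp add: xs(1) acts_on_subsets_of_size)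
qed

lemma standard_sets_eq_Union:
  assumes "r \<le> 2 * n - 4"
  shows "standard_sets n r = (\<Union>l<Suc (min r (2 * n - 4 - r)). subsets_of_size l (n - 1))"
  using assms by (auto simp: standard_sets_def subsets_of_size_def)

text \<open>List the standard sets by increasing cardinality; each block of the list is invariant, and its class
  is that of the subsets of this size. In degrees above \<open>2n - 4\<close> there are no standard sets. These
  degrees are listed separately because the truncated difference \<open>2 * n - 4 - r\<close> is
  \<open>0\<close> there, which would leave the summand with \<open>l = 0\<close>.\<close>

lemma rep_class_component_eq_sum:
  fixes n r :: nat
  assumes "n \<ge> 2"
  defines "R \<equiv> rep_ring (sym_group (n - 1)) :: (((nat \<Rightarrow> nat) \<Rightarrow> 'a::field_char_0 mat) \<Rightarrow>\<^sub>0 int) set ring"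
  shows "rep_class (sym_group (n - 1)) (quot_component n (J_ideal n :: 'a mpoly set) r) permute_cosets =
    (if r \<le> 2 * n - 4 then \<Oplus>\<^bsub>R\<^esub>l\<in>{0..min r (2 * n - 4 - r)}. subset_rep_class l (n - 1) else \<zero>\<^bsub>R\<^esub>)"
proof -
  have monoid: "Group.monoid (sym_group (n - 1))"
    using sym_group_is_group by (rule group.is_monoid)
  show ?thesis
  proof (cases "r \<le> 2 * n - 4")
    case True
    define m where "m = Suc (min r (2 * n - 4 - r))"
    have "\<exists>xs. set xs = subsets_of_size l (n - 1) \<and> distinct xs" for l
      by (rule finite_distinct_list[OF finite_subsets_of_size])
    then obtain L where L: "\<And>l. set (L l) = subsets_of_size l (n - 1)" "\<And>l. distinct (L l)"
      by metis
    have "distinct (concat (map L [0..<k]))" for k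
    proof (induction k)
      case (Suc k)
      then show ?case
        using L by (auto simp: subsets_of_size_def)
    qed simp
    note distinct = this[of m]
    have "set (concat (map L [0..<m])) = standard_sets n r"
      unfolding standard_sets_eq_Union[OF True] m_def[symmetric] by (auto simp: L(1))
    from rep_class_component[OF assms(1) distinct this, where 'a = 'a]
    have "rep_class (sym_group (n - 1)) (quot_component n (J_ideal n :: 'a mpoly set) r) permute_cosets =
        mat_rep_class (sym_group (n - 1)) (perm_rep image (concat (map L [0..<m])))" .
    also have "\<dots> = (\<Oplus>\<^bsub>R\<^esub>l\<in>{..<m}. mat_rep_class (sym_group (n - 1)) (perm_rep image (L l)))"
      unfolding R_def
      by (rule mat_rep_class_perm_rep_concat[OF monoid distinct]) (simp add: L(1) acts_on_subsets_of_size)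
    also have "\<dots> = (\<Oplus>\<^bsub>R\<^esub>l\<in>{..<m}. subset_rep_class l (n - 1))"
      by (simp only: subset_rep_class_eq[OF L(2,1)])
    also have "{..<m} = {0..min r (2 * n - 4 - r)}"
      by (auto simp: m_def)
    finally show ?thesis
      using True by simp
  next
    case False
    have "rep_class (sym_group (n - 1)) (quot_component n (J_ideal n :: 'a mpoly set) r) permute_cosets =
        mat_rep_class (sym_group (n - 1)) (perm_rep image [])"
      using False by (intro rep_class_component[OF assms(1)]) (auto simp: standard_sets_def)
    then show ?thesis
      unfolding mat_rep_class_perm_rep_Nil[OF monoid] R_def using False by simp
  qed
qed

text \<open>Polynomials are represented by their coefficient functions, so the identity of graded characters can
  be checked degree by degree.\<close>

lemma UP_finsum_monom:
  fixes R (structure)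
  assumes "ring R" "\<And>k. s k \<in> carrier R"
  shows "(\<Oplus>\<^bsub>UP R\<^esub> k \<in> {0..N}. up_ring.monom (UP R) (s k) k) r = (if r \<le> N then s r else \<zero>)"
proof -
  interpret ring R
    by (rule assms(1))
  interpret U: UP_ring R "UP R"
    by unfold_locales
  define F where "F = (\<Oplus>\<^bsub>UP R\<^esub> k \<in> {0..N}. up_ring.monom (UP R) (s k) k)"
  have "F \<in> carrier (UP R)"
    unfolding F_def by (intro U.P.finsum_closed Pi_I U.monom_closed assms(2))
  then have "F r = up_ring.coeff (UP R) F r"
    by (simp add: UP_def)
  also have "\<dots> = (\<Oplus>k \<in> {0..N}. up_ring.coeff (UP R) (up_ring.monom (UP R) (s k) k) r)"
    unfolding F_def by (rule U.coeff_finsum) (simp_all add: assms(2))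
  also have "\<dots> = (\<Oplus>k \<in> {0..N}. if r = k then s k else \<zero>)"
    by (intro finsum_cong') (auto simp: assms(2))
  also have "\<dots> = (if r \<le> N then s r else \<zero>)"
  proof (cases "r \<le> N")
    case True
    then show ?thesis
      using add.finprod_singleton[of r "{0..N}" s] assms(2) by simp
  next
    case False
    then have "(\<Oplus>k \<in> {0..N}. if r = k then s k else \<zero>) = (\<Oplus>k \<in> {0..N}. \<zero>)"
      by (intro finsum_cong') auto
    then show ?thesis
      using False by simp
  qed
  finally show ?thesis
    unfolding F_def .
qed

theorem theorem3p4:
  fixes n :: nat
  assumes "n \<ge> 2"
  shows "graded_char (sym_group (n - 1))
           (quot_component n (J_ideal n :: 'a::{alg_closed_field, field_char_0} mpoly set))
           permute_cosets =
         (\<Oplus>\<^bsub>UP (rep_ring (sym_group (n - 1)))\<^esub> k \<in> {0..2 * n - 4}.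
            up_ring.monom (UP (rep_ring (sym_group (n - 1))))
              (\<Oplus>\<^bsub>rep_ring (sym_group (n - 1))\<^esub> l \<in> {0..min k (2 * n - 4 - k)}.
                 subset_rep_class l (n - 1))
              k)"
proof
  fix r
  let ?R = "rep_ring (sym_group (n - 1)) :: (((nat \<Rightarrow> nat) \<Rightarrow> 'a mat) \<Rightarrow>\<^sub>0 int) set ring"
  define s where "s k = (\<Oplus>\<^bsub>?R\<^esub> l \<in> {0..min k (2 * n - 4 - k)}. subset_rep_class l (n - 1))" for k
  interpret ring ?R
    by (rule rep_ring_ring)
  have "s k \<in> carrier ?R" for k
    unfolding s_def by (intro finsum_closed Pi_I subset_rep_class_closed)
  from UP_finsum_monom[where s = s and N = "2 * n - 4" and r = r, OF rep_ring_ring this]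
  show "graded_char (sym_group (n - 1)) (quot_component n (J_ideal n :: 'a mpoly set)) permute_cosets r =
      (\<Oplus>\<^bsub>UP ?R\<^esub> k \<in> {0..2 * n - 4}. up_ring.monom (UP ?R)
        (\<Oplus>\<^bsub>?R\<^esub> l \<in> {0..min k (2 * n - 4 - k)}. subset_rep_class l (n - 1)) k) r"
    unfolding graded_char_def rep_class_component_eq_sum[OF assms] s_def by (rule sym)
qed

end
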